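(* Let $\Omega\subset\mathbb{R}^2$ be a bounded open set and let $H$ be a polarizer such that an eigenfunction corresponding to $\tau_1(\Omega)$ is positive on $\Omega\setminus\sigma_H(\Omega)$. Then $$\tau_1(\Omega)\le \tau_1(P_H(\Omega)).$$ Moreover, equality $\tau_1(\Omega)=\tau_1(P_H(\Omega))$ holds only if $P_H(\Omega)\cong\Omega$ or $P_H(\Omega)\cong\sigma_H(\Omega)$.
   Context: For a bounded open set $\Omega\subset\mathbb{R}^2$, the Logarithmic potential operator $\mathcal{L}$ on $L^2(\Omega)$ (real-valued functions) is $\mathcal{L}u(x)=\frac{1}{2\pi}\int_\Omega \log\frac{1}{|x-y|}\,u(y)\,dy$; it is self-adjoint and compact. Its largest eigenvalue is denoted $\tau_1(\Omega)$ and satisfies $\tau_1(\Omega)=\sup\{E(u):u\in L^2(\Omega),\ \|u\|_{L^2(\Omega)}=1\}$, where $E(u)=\frac{1}{2\pi}\int_\Omega\int_\Omega\log\frac{1}{|x-y|}u(x)u(y)\,dx\,dy$. Eigenfunctions are taken in their continuous representatives. A polarizer $H$ is an open affine half-space of $\mathbb{R}^N$ (here $N=2$); $\sigma_H$ denotes the reflection with respect to the boundary $\partial H$. For $\Omega\subset\mathbb{R}^N$, the polarization of $\Omega$ with respect to $H$ is $P_H(\Omega)=[(\Omega\cup\sigma_H(\Omega))\cap H]\cup[\Omega\cap\sigma_H(\Omega)]$. For measurable sets $A,B$, $A\cong B$ means $|A\triangle B|=0$, where $\triangle$ is the symmetric difference and $|\cdot|$ is Lebesgue measure. *)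

theory Defs
  imports "HOL-Analysis.Analysis"
begin

section \<open>The logarithmic potential operator on a planar set\<close>

text \<open>
  Elements of $L^2(\Omega)$ are represented by functions on the whole plane; only their
  restriction to \<open>\<Omega>\<close> matters, and equality in $L^2(\Omega)$ is equality almost everywhere
  on \<open>\<Omega>\<close>.
\<close>

definition L2_on :: "(real ^ 2) set \<Rightarrow> (real ^ 2 \<Rightarrow> real) set" where
  "L2_on \<Omega> = {u \<in> borel_measurable (lebesgue_on \<Omega>). integrable (lebesgue_on \<Omega>) (\<lambda>x. (u x)\<^sup>2)}"

text \<open>
  At the single point \<open>y = x\<close> the kernel takes the junk value \<open>ln (1 / 0) = 0\<close>, which does not
  affect the integral.
\<close>

definition log_potential :: "(real ^ 2) set \<Rightarrow> (real ^ 2 \<Rightarrow> real) \<Rightarrow> real ^ 2 \<Rightarrow> real" where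
  "log_potential \<Omega> u x =
     1 / (2 * pi) * (\<integral>y. ln (1 / norm (x - y)) * u y \<partial>(lebesgue_on \<Omega>))"

definition log_eigenfunction :: "(real ^ 2) set \<Rightarrow> real \<Rightarrow> (real ^ 2 \<Rightarrow> real) \<Rightarrow> bool" where
  "log_eigenfunction \<Omega> \<tau> u \<longleftrightarrow>
     u \<in> L2_on \<Omega> \<and> \<not> (AE x in lebesgue_on \<Omega>. u x = 0) \<and>
     (AE x in lebesgue_on \<Omega>. log_potential \<Omega> u x = \<tau> * u x)"

definition log_eigenvalue :: "(real ^ 2) set \<Rightarrow> real \<Rightarrow> bool" where
  "log_eigenvalue \<Omega> \<tau> \<longleftrightarrow> (\<exists>u. log_eigenfunction \<Omega> \<tau> u)"

text \<open>
  For nonempty bounded open \<open>\<Omega>\<close> the largest eigenvalue exists (and is positive); for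
  \<open>\<Omega> = {}\<close> there are no eigenvalues and the value below is unspecified.
\<close>

definition tau1 :: "(real ^ 2) set \<Rightarrow> real" where
  "tau1 \<Omega> = (GREATEST \<tau>. log_eigenvalue \<Omega> \<tau>)"


section \<open>Polarization\<close>

definition polarizer :: "'a::euclidean_space set \<Rightarrow> bool" where
  "polarizer H \<longleftrightarrow> (\<exists>a b. a \<noteq> 0 \<and> H = {x. a \<bullet> x < b})"

text \<open>
  The boundary of a polarizer is an affine hyperplane, so \<^const>\<open>closest_point\<close> is the
  orthogonal projection onto it.
\<close>

definition reflection :: "'a::euclidean_space set \<Rightarrow> 'a \<Rightarrow> 'a" where
  "reflection H x = 2 *\<^sub>R closest_point (frontier H) x - x"

definition polarization :: "'a::euclidean_space set \<Rightarrow> 'a set \<Rightarrow> 'a set" where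
  "polarization H \<Omega> =
     ((\<Omega> \<union> reflection H ` \<Omega>) \<inter> H) \<union> (\<Omega> \<inter> reflection H ` \<Omega>)"

lemma reflection_halfspace:
  fixes a :: "'a::euclidean_space"
  assumes "a \<noteq> 0"
  shows "reflection {x. a \<bullet> x < b} x = x - (2 * (a \<bullet> x - b) / (a \<bullet> a)) *\<^sub>R a"
proof -
  let ?S = "{z. a \<bullet> z = b}"
  define t where "t = (a \<bullet> x - b) / (a \<bullet> a)"
  define p where "p = x - t *\<^sub>R a"
  have aa: "a \<bullet> a \<noteq> 0" using assms by simp
  have p: "a \<bullet> p = b"
    using aa by (simp add: p_def t_def inner_diff_right)
  have "dist x p \<le> dist x z" if "z \<in> ?S" for z
  proof -
    have "a \<bullet> (p - z) = 0"
      using that p by (simp add: inner_diff_right)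
    moreover have "x - p = t *\<^sub>R a"
      by (simp add: p_def)
    ultimately have "orthogonal (p - z) (x - p)"
      by (simp add: orthogonal_def inner_commute)
    from norm_add_Pythagorean[OF this]
    have "(norm (x - z))\<^sup>2 = (norm (p - z))\<^sup>2 + (norm (x - p))\<^sup>2"
      by simp
    then have "(norm (x - p))\<^sup>2 \<le> (norm (x - z))\<^sup>2"
      by simp
    then show ?thesis
      unfolding dist_norm by (rule power2_le_imp_le) simp
  qed
  then have "p = closest_point ?S x"
    using p by (intro closest_point_unique convex_hyperplane closed_hyperplane) auto
  moreover have "frontier {x. a \<bullet> x < b} = ?S"
    using assms by (simp add: frontier_halfspace_lt)
  ultimately have "reflection {x. a \<bullet> x < b} x = 2 *\<^sub>R p - x"
    by (simp add: reflection_def)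
  also have "\<dots> = x - (2 * t) *\<^sub>R a"
    by (simp add: p_def scaleR_right_diff_distrib scaleR_2)
  finally show ?thesis
    by (simp add: t_def)
qed


section \<open>Equality up to null sets\<close>

definition ess_equal :: "'a::euclidean_space set \<Rightarrow> 'a set \<Rightarrow> bool"  (infix \<open>\<cong>\<^sub>0\<close> 50) where
  "A \<cong>\<^sub>0 B \<longleftrightarrow> sym_diff A B \<in> null_sets lebesgue"

end

theory Submission
  imports Defs "HOL-Complex_Analysis.Great_Picard"
begin

text \<open>
  Extend the eigenfunction $u$ by zero and polarize it: let $v(x)$ be the larger of $u(x)$ and
  $u(\sigma x)$ for $x \in H$ and the smaller one outside $H$. This preserves the $L^2$ norm.
  Since $u > 0$ on $\Omega \setminus \sigma(\Omega)$, the function $v$ vanishes outside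
  $P_H(\Omega)$; with negative values there, the minimum would not vanish at points of
  $\Omega \setminus (\sigma(\Omega) \cup H)$. If polarization does not decrease the
  logarithmic energy $E$, then $\tau_1(\Omega)\|u\|^2 = E(u) \le E(v) \le
  \tau_1(P_H(\Omega))\|v\|^2$, the last step being the variational principle on $P_H(\Omega)$.

  Energy (\<open>form_polarize\<close>, \<open>form_align_sign\<close>). Split $u$ into its even and odd parts under
  $\sigma$. They do not interact, and polarization changes only the odd part $d$, to $|d|$ on $H$
  and $-|d|$ outside. For odd functions the energy can be written with the kernel
  $k(x,y) - k(x,\sigma y)$, which is positive for points on the same side of the axis and
  negative for points on different sides; so the change of $d$ turns the integrand into its absolute
  value.

  Equality. If the two eigenvalues agree, then $E(u) = E(v)$, hence $d(x)d(y) \ge 0$ for almost all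
  $x, y \in H$, and $d$ has a constant sign almost everywhere on $H$. If $d \ge 0$ there, the positivity of
  $u$ on $\Omega \setminus \sigma(\Omega)$ leaves only a null part of that set outside $H$, which
  means $P_H(\Omega) \cong \Omega$; if $d \le 0$, then $P_H(\Omega) \cong \sigma(\Omega)$ in
  the same way.

  Variational principle (\<open>log_form_le_tau1\<close>, \<open>exists_maximal_eigenfunction\<close>). Potentials of
  $L^2$-bounded functions are equicontinuous, because the kernel is square integrable with a modulus
  of continuity in the mean that is uniform in the base point. So the maximum of the Rayleigh quotient is attained, and it is
  the greatest eigenvalue.
\<close>

section \<open>Square-integrable functions\<close>

definition square_integrable :: "'a measure \<Rightarrow> ('a \<Rightarrow> real) set" where
  "square_integrable M = {u \<in> borel_measurable M. integrable M (\<lambda>x. (u x)\<^sup>2)}"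

lemma square_integrableD:
  assumes "u \<in> square_integrable M"
  shows "u \<in> borel_measurable M" "integrable M (\<lambda>x. (u x)\<^sup>2)"
  using assms by (auto simp: square_integrable_def)

lemma square_integrable_cmult:
  assumes "u \<in> square_integrable M"
  shows "(\<lambda>x. c * u x) \<in> square_integrable M"
  using assms by (auto simp: square_integrable_def power_mult_distrib)

lemma integrable_mult_square_integrable:
  assumes "u \<in> square_integrable M" "v \<in> square_integrable M"
  shows "integrable M (\<lambda>x. u x * v x)"
proof (rule Bochner_Integration.integrable_bound)
  show "integrable M (\<lambda>x. (u x)\<^sup>2 + (v x)\<^sup>2)"
    using assms by (auto dest: square_integrableD)
  show "(\<lambda>x. u x * v x) \<in> borel_measurable M"
    using square_integrableD(1)[OF assms(1)] square_integrableD(1)[OF assms(2)] by simp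
  have "\<bar>u x * v x\<bar> \<le> (u x)\<^sup>2 + (v x)\<^sup>2" for x
    using sum_squares_bound[of "\<bar>u x\<bar>" "\<bar>v x\<bar>"] abs_ge_zero[of "u x * v x"]
    unfolding abs_mult power2_abs by linarith
  then show "AE x in M. norm (u x * v x) \<le> norm ((u x)\<^sup>2 + (v x)\<^sup>2)"
    by simp
qed

lemma square_integrable_add:
  assumes "u \<in> square_integrable M" "v \<in> square_integrable M"
  shows "(\<lambda>x. u x + v x) \<in> square_integrable M"
  using assms integrable_mult_square_integrable[OF assms]
  by (auto simp: square_integrable_def power2_sum mult.assoc)

lemma square_integrable_diff:
  assumes "u \<in> square_integrable M" "v \<in> square_integrable M"
  shows "(\<lambda>x. u x - v x) \<in> square_integrable M"
  using square_integrable_add[OF assms(1) square_integrable_cmult[OF assms(2), of "-1"]] by simp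

lemma square_integrable_abs_eq:
  assumes "u \<in> square_integrable M" "v \<in> borel_measurable M"
    and "\<And>x. x \<in> space M \<Longrightarrow> \<bar>v x\<bar> = \<bar>u x\<bar>"
  shows "v \<in> square_integrable M"
proof -
  have "integrable M (\<lambda>x. (v x)\<^sup>2) = integrable M (\<lambda>x. (u x)\<^sup>2)"
    using assms(3) by (intro Bochner_Integration.integrable_cong) (auto simp: power2_eq_iff abs_eq_iff)
  then show ?thesis
    using assms by (auto simp: square_integrable_def)
qed

lemma (in finite_measure) square_integrable_bounded:
  assumes "u \<in> borel_measurable M" "\<And>x. x \<in> space M \<Longrightarrow> \<bar>u x\<bar> \<le> c"
  shows "u \<in> square_integrable M"
proof -
  have "integrable M (\<lambda>x. (u x)\<^sup>2)"
  proof (rule integrable_const_bound)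
    show "AE x in M. norm ((u x)\<^sup>2) \<le> c\<^sup>2"
      using assms(2) by (intro AE_I2) (simp add: abs_le_square_iff[symmetric], smt (verit))
  qed (use assms in auto)
  then show ?thesis
    using assms by (auto simp: square_integrable_def)
qed

lemma (in finite_measure) square_integrable_imp_integrable:
  assumes "u \<in> square_integrable M"
  shows "integrable M u"
  using integrable_mult_square_integrable[OF assms square_integrable_bounded[of "\<lambda>_. 1" 1]] by simp

text \<open>The discriminant criterion behind every Cauchy--Schwarz inequality.\<close>

lemma quadratic_nonneg_imp_discriminant:
  fixes a b c :: real
  assumes nonneg: "\<And>t. 0 \<le> a - 2 * t * b + t\<^sup>2 * c"
    and c_nonneg: "0 \<le> c"
  shows "b\<^sup>2 \<le> a * c"
proof (cases "c = 0")
  case True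
  have "b = 0"
    using nonneg[of "(a + 1) / (2 * b)"] True by (cases "b = 0") auto
  then show ?thesis using True by simp
next
  case False
  then have "c > 0" using c_nonneg by simp
  then show ?thesis
    using nonneg[of "b / c"] by (simp add: field_simps power2_eq_square)
qed

lemma Cauchy_Schwarz_integral:
  assumes "u \<in> square_integrable M" "v \<in> square_integrable M"
  shows "(\<integral>x. u x * v x \<partial>M)\<^sup>2 \<le> (\<integral>x. (u x)\<^sup>2 \<partial>M) * (\<integral>x. (v x)\<^sup>2 \<partial>M)"
proof (rule quadratic_nonneg_imp_discriminant)
  fix t
  have "0 \<le> (\<integral>x. (u x - t * v x)\<^sup>2 \<partial>M)" by simp
  also have "\<dots> = (\<integral>x. (u x)\<^sup>2 - 2 * t * (u x * v x) + t\<^sup>2 * (v x)\<^sup>2 \<partial>M)"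
    by (simp add: power2_diff power_mult_distrib algebra_simps)
  also have "\<dots> = (\<integral>x. (u x)\<^sup>2 \<partial>M) - 2 * t * (\<integral>x. u x * v x \<partial>M) + t\<^sup>2 * (\<integral>x. (v x)\<^sup>2 \<partial>M)"
    using assms integrable_mult_square_integrable[OF assms] by (simp add: square_integrableD)
  finally show "0 \<le> (\<integral>x. (u x)\<^sup>2 \<partial>M) - 2 * t * (\<integral>x. u x * v x \<partial>M) + t\<^sup>2 * (\<integral>x. (v x)\<^sup>2 \<partial>M)" .
qed simp

lemma abs_integral_mult_le_sqrt:
  assumes "u \<in> square_integrable M" "v \<in> square_integrable M"
    and "(\<integral>x. (u x)\<^sup>2 \<partial>M) \<le> A"
  shows "\<bar>\<integral>x. u x * v x \<partial>M\<bar> \<le> sqrt (A * (\<integral>x. (v x)\<^sup>2 \<partial>M))"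
proof -
  have "(\<integral>x. u x * v x \<partial>M)\<^sup>2 \<le> A * (\<integral>x. (v x)\<^sup>2 \<partial>M)"
    using Cauchy_Schwarz_integral[OF assms(1,2)] mult_right_mono[OF assms(3), of "\<integral>x. (v x)\<^sup>2 \<partial>M"]
    by simp
  then show ?thesis by (simp add: real_le_rsqrt)
qed

section \<open>Operators with a square-integrable kernel\<close>

text \<open>
  The $L^2$ bound on the sections \<open>k x\<close> is uniform in \<open>x\<close>. On a finite measure space this
  is what makes every double integral below absolutely convergent and every potential bounded,
  although the kernel itself is unbounded.
\<close>

locale bounded_kernel = finite_measure M for M :: "'a measure" +
  fixes k :: "'a \<Rightarrow> 'a \<Rightarrow> real" and C :: real
  assumes measurable_kernel: "(\<lambda>(x, y). k x y) \<in> borel_measurable (M \<Otimes>\<^sub>M M)"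
    and kernel_square_integrable: "\<And>x. x \<in> space M \<Longrightarrow> k x \<in> square_integrable M"
    and kernel_bound: "\<And>x. x \<in> space M \<Longrightarrow> (\<integral>y. (k x y)\<^sup>2 \<partial>M) \<le> C"
begin

sublocale pair: pair_sigma_finite M M ..

definition op :: "('a \<Rightarrow> real) \<Rightarrow> 'a \<Rightarrow> real" where
  "op u x = (\<integral>y. k x y * u y \<partial>M)"

definition form :: "('a \<Rightarrow> real) \<Rightarrow> ('a \<Rightarrow> real) \<Rightarrow> real" where
  "form u v = (\<integral>x. u x * op v x \<partial>M)"

lemma integrable_kernel:
  assumes "u \<in> square_integrable M" "x \<in> space M"
  shows "integrable M (\<lambda>y. k x y * u y)"
  by (rule integrable_mult_square_integrable) (use assms kernel_square_integrable in auto)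

lemma abs_op_le:
  assumes "u \<in> square_integrable M" "x \<in> space M"
  shows "\<bar>op u x\<bar> \<le> sqrt (C * (\<integral>y. (u y)\<^sup>2 \<partial>M))"
  unfolding op_def
  by (rule abs_integral_mult_le_sqrt) (use assms kernel_square_integrable kernel_bound in auto)

lemma measurable_op:
  assumes [measurable]: "u \<in> borel_measurable M"
  shows "op u \<in> borel_measurable M"
proof -
  note measurable_kernel[measurable]
  have "(\<lambda>x. \<integral>y. k x y * u y \<partial>M) \<in> borel_measurable M"
    by measurable
  then show ?thesis unfolding op_def[abs_def] .
qed

lemma op_square_integrable:
  assumes "u \<in> square_integrable M"
  shows "op u \<in> square_integrable M"
  by (rule square_integrable_bounded[OF measurable_op abs_op_le])
     (use assms square_integrableD in auto)

lemma op_add: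
  assumes "u \<in> square_integrable M" "v \<in> square_integrable M" "x \<in> space M"
  shows "op (\<lambda>x. u x + v x) x = op u x + op v x"
  unfolding op_def using assms by (simp add: distrib_left integrable_kernel)

lemma op_cmult: "op (\<lambda>x. c * u x) x = c * op u x"
  unfolding op_def by (simp add: mult.left_commute)

lemma integrable_form:
  assumes "u \<in> square_integrable M" "v \<in> square_integrable M"
  shows "integrable M (\<lambda>x. u x * op v x)"
  by (rule integrable_mult_square_integrable) (use assms op_square_integrable in auto)

lemma form_add_left:
  assumes "u \<in> square_integrable M" "v \<in> square_integrable M" "w \<in> square_integrable M"
  shows "form (\<lambda>x. u x + v x) w = form u w + form v w"
  unfolding form_def using assms by (simp add: distrib_right integrable_form)

lemma form_cmult_left: "form (\<lambda>x. c * u x) w = c * form u w"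
  unfolding form_def by (simp add: mult.assoc)

lemma form_add_right:
  assumes "u \<in> square_integrable M" "v \<in> square_integrable M" "w \<in> square_integrable M"
  shows "form w (\<lambda>x. u x + v x) = form w u + form w v"
proof -
  have "form w (\<lambda>x. u x + v x) = (\<integral>x. w x * op u x + w x * op v x \<partial>M)"
    unfolding form_def using assms
    by (intro Bochner_Integration.integral_cong refl) (simp add: op_add algebra_simps)
  then show ?thesis
    unfolding form_def using assms by (simp add: integrable_form)
qed

lemma form_cmult_right: "form w (\<lambda>x. c * u x) = c * form w u"
  unfolding form_def by (simp add: op_cmult mult.left_commute)

lemma abs_form_le:
  assumes "u \<in> square_integrable M"
  shows "\<bar>form u u\<bar> \<le> sqrt (measure M (space M) * C) * (\<integral>x. (u x)\<^sup>2 \<partial>M)"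
proof -
  let ?n = "\<integral>x. (u x)\<^sup>2 \<partial>M"
  have "(\<integral>x. (op u x)\<^sup>2 \<partial>M) \<le> (\<integral>x. C * ?n \<partial>M)"
  proof (rule integral_mono)
    fix x assume x: "x \<in> space M"
    have C: "0 \<le> C * ?n"
      using kernel_bound[OF x] order_trans[of 0 "\<integral>y. (k x y)\<^sup>2 \<partial>M" C] by simp
    have "(op u x)\<^sup>2 \<le> (sqrt (C * ?n))\<^sup>2"
      using abs_op_le[OF assms x] by (metis abs_ge_zero power2_abs power_mono)
    then show "(op u x)\<^sup>2 \<le> C * ?n" using C by simp
  qed (use square_integrableD(2)[OF op_square_integrable[OF assms]] in auto)
  then have *: "(\<integral>x. (op u x)\<^sup>2 \<partial>M) \<le> measure M (space M) * C * ?n"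
    by (simp add: mult.assoc)
  have "\<bar>form u u\<bar> = \<bar>\<integral>x. op u x * u x \<partial>M\<bar>" by (simp add: form_def mult.commute)
  also have "\<dots> \<le> sqrt (measure M (space M) * C * ?n * ?n)"
    by (rule abs_integral_mult_le_sqrt[OF op_square_integrable[OF assms] assms *])
  also have "\<dots> = sqrt (measure M (space M) * C) * ?n"
    by (simp add: real_sqrt_mult)
  finally show ?thesis .
qed

text \<open>
  Integrating out the second variable first leaves \<open>\<bar>u\<bar>\<close> times the potential of \<open>\<bar>v\<bar>\<close> for
  the kernel \<open>\<bar>k\<bar>\<close>, which is bounded by Cauchy--Schwarz.
\<close>

lemma integrable_kernel_pair:
  assumes u: "u \<in> square_integrable M" and v: "v \<in> square_integrable M"
  shows "integrable (M \<Otimes>\<^sub>M M) (\<lambda>(x, y). k x y * (u x * v y))"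
proof (rule pair.Fubini_integrable)
  note measurable_kernel[measurable]
  have [measurable]: "u \<in> borel_measurable M" "v \<in> borel_measurable M"
    using assms by (auto dest: square_integrableD)
  show "(\<lambda>(x, y). k x y * (u x * v y)) \<in> borel_measurable (M \<Otimes>\<^sub>M M)"
    by measurable
  have eq: "(\<integral>y. norm (case (x, y) of (x, y) \<Rightarrow> k x y * (u x * v y)) \<partial>M)
      = \<bar>u x\<bar> * (\<integral>y. \<bar>k x y\<bar> * \<bar>v y\<bar> \<partial>M)" for x
    by (simp add: abs_mult mult.left_commute)
  have meas: "(\<lambda>x. \<integral>y. \<bar>k x y\<bar> * \<bar>v y\<bar> \<partial>M) \<in> borel_measurable M"
    by measurable
  have abs_v: "(\<lambda>y. \<bar>v y\<bar>) \<in> square_integrable M"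
    by (rule square_integrable_abs_eq[OF v]) auto
  have abs_k: "(\<lambda>y. \<bar>k x y\<bar>) \<in> square_integrable M" if "x \<in> space M" for x
    by (rule square_integrable_abs_eq[OF kernel_square_integrable[OF that]])
       (use square_integrableD[OF kernel_square_integrable[OF that]] in auto)
  have "\<bar>\<integral>y. \<bar>k x y\<bar> * \<bar>v y\<bar> \<partial>M\<bar> \<le> sqrt (C * (\<integral>y. \<bar>v y\<bar>\<^sup>2 \<partial>M))" if "x \<in> space M" for x
    by (rule abs_integral_mult_le_sqrt[OF abs_k abs_v]) (use that kernel_bound in auto)
  then have "(\<lambda>x. \<integral>y. \<bar>k x y\<bar> * \<bar>v y\<bar> \<partial>M) \<in> square_integrable M"
    using meas by (rule square_integrable_bounded[rotated])
  moreover have "(\<lambda>y. \<bar>u y\<bar>) \<in> square_integrable M"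
    by (rule square_integrable_abs_eq[OF u]) auto
  ultimately show "integrable M (\<lambda>x. \<integral>y. norm (case (x, y) of (x, y) \<Rightarrow> k x y * (u x * v y)) \<partial>M)"
    unfolding eq by (intro integrable_mult_square_integrable)
  show "AE x in M. integrable M (\<lambda>y. case (x, y) of (x, y) \<Rightarrow> k x y * (u x * v y))"
    using integrable_kernel[OF v] by (intro AE_I2) (simp add: mult.left_commute)
qed

lemma form_eq_pair:
  assumes u: "u \<in> square_integrable M" and v: "v \<in> square_integrable M"
  shows "form u v = (\<integral>(x, y). k x y * (u x * v y) \<partial>(M \<Otimes>\<^sub>M M))"
proof -
  have "form u v = (\<integral>x. \<integral>y. (case (x, y) of (x, y) \<Rightarrow> k x y * (u x * v y)) \<partial>M \<partial>M)"
    by (simp add: form_def op_def mult.left_commute flip: integral_mult_right_zero)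
  also have "\<dots> = (\<integral>(x, y). k x y * (u x * v y) \<partial>(M \<Otimes>\<^sub>M M))"
    by (rule pair.integral_fst'[OF integrable_kernel_pair[OF assms]])
  finally show ?thesis .
qed

end

locale symmetric_kernel = bounded_kernel +
  assumes kernel_commute: "\<And>x y. k x y = k y x"
begin

lemma form_commute:
  assumes u: "u \<in> square_integrable M" and v: "v \<in> square_integrable M"
  shows "form u v = form v u"
proof -
  have "form u v = (\<integral>(x, y). (\<lambda>(x, y). k x y * (u x * v y)) (y, x) \<partial>(M \<Otimes>\<^sub>M M))"
    using form_eq_pair[OF assms]
      pair.integral_product_swap[of "\<lambda>(x, y). k x y * (u x * v y)"] integrable_kernel_pair[OF assms]
    by simp
  also have "\<dots> = (\<integral>(x, y). k x y * (v x * u y) \<partial>(M \<Otimes>\<^sub>M M))"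
    by (simp add: kernel_commute mult.commute[of "v _"])
  finally show ?thesis using form_eq_pair[OF v u] by simp
qed

end

section \<open>Attainment of the maximal Rayleigh quotient\<close>

lemma power2_add_le: "(a + b)\<^sup>2 \<le> 2 * a\<^sup>2 + 2 * (b::real)\<^sup>2"
  using zero_le_power2[of "a - b"] unfolding power2_sum power2_diff by linarith

lemma integral_power2_diff_le:
  assumes "u \<in> square_integrable M" "v \<in> square_integrable M" "w \<in> square_integrable M"
  shows "(\<integral>x. (u x - w x)\<^sup>2 \<partial>M) \<le> 2 * (\<integral>x. (u x - v x)\<^sup>2 \<partial>M) + 2 * (\<integral>x. (v x - w x)\<^sup>2 \<partial>M)"
proof -
  note sq = square_integrableD(2)[OF square_integrable_diff]
  have "(\<integral>x. (u x - w x)\<^sup>2 \<partial>M) \<le> (\<integral>x. 2 * (u x - v x)\<^sup>2 + 2 * (v x - w x)\<^sup>2 \<partial>M)"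
  proof (rule integral_mono)
    show "(u x - w x)\<^sup>2 \<le> 2 * (u x - v x)\<^sup>2 + 2 * (v x - w x)\<^sup>2" for x
      using power2_add_le[of "u x - v x" "v x - w x"] by simp
  qed (intro Bochner_Integration.integrable_add integrable_mult_right sq assms)+
  then show ?thesis using sq[OF assms(1,2)] sq[OF assms(2,3)] by simp
qed

lemma not_AE_zero_imp_integral_pos:
  assumes "u \<in> square_integrable M" "\<not> (AE x in M. u x = 0)"
  shows "(\<integral>x. (u x)\<^sup>2 \<partial>M) > 0"
proof -
  have "(\<integral>x. (u x)\<^sup>2 \<partial>M) \<noteq> 0"
    using assms by (subst integral_nonneg_eq_0_iff_AE) (auto dest: square_integrableD)
  then show ?thesis by (simp add: order_less_le)
qed

context symmetric_kernel
begin

lemma form_scale: "form (\<lambda>x. c * u x) (\<lambda>x. c * u x) = c\<^sup>2 * form u u"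
  by (simp add: form_cmult_left form_cmult_right power2_eq_square)

lemma form_diff_scale:
  assumes u: "u \<in> square_integrable M" and w: "w \<in> square_integrable M"
  shows "form (\<lambda>x. u x - t * w x) (\<lambda>x. u x - t * w x) = form u u - 2 * t * form u w + t\<^sup>2 * form w w"
proof -
  note tw = square_integrable_cmult[OF w, of "- t"]
  have "form (\<lambda>x. u x + (- t) * w x) (\<lambda>x. u x + (- t) * w x)
      = form u u + (- t) * form u w + (- t) * (form w u + (- t) * form w w)"
    using u w tw square_integrable_add[OF u tw]
    by (simp only: form_add_left form_add_right form_cmult_left form_cmult_right)
  then show ?thesis
    using form_commute[OF w u] by (simp add: power2_eq_square algebra_simps)
qed

text \<open>
  The form $m\langle u,w\rangle - \langle u,Kw\rangle$ is positive semidefinite, so it obeys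
  Cauchy--Schwarz. Applied to $u$ and $w = mu - Ku$, whose pairing is $\|w\|^2$, this bounds the
  residual of $u$ as an approximate eigenfunction by its defect as a maximizer.
\<close>

lemma residual_bound:
  assumes le: "\<And>w. w \<in> square_integrable M \<Longrightarrow> form w w \<le> m * (\<integral>x. (w x)\<^sup>2 \<partial>M)"
    and u: "u \<in> square_integrable M"
  shows "(\<integral>x. (m * u x - op u x)\<^sup>2 \<partial>M)
    \<le> (m + sqrt (measure M (space M) * C)) * (m * (\<integral>x. (u x)\<^sup>2 \<partial>M) - form u u)"
proof -
  define w where "w x = m * u x - op u x" for x
  define c where "c = m + sqrt (measure M (space M) * C)"
  define q where "q = m * (\<integral>x. (u x)\<^sup>2 \<partial>M) - form u u"
  let ?N = "\<integral>x. (w x)\<^sup>2 \<partial>M"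
  have w: "w \<in> square_integrable M"
    unfolding w_def[abs_def]
    by (intro square_integrable_diff square_integrable_cmult op_square_integrable u)
  have uw: "integrable M (\<lambda>x. u x * w x)" "integrable M (\<lambda>x. (u x)\<^sup>2)" "integrable M (\<lambda>x. (w x)\<^sup>2)"
    using u w by (auto intro: integrable_mult_square_integrable square_integrableD)
  have "form u w = (\<integral>x. w x * op u x \<partial>M)"
    by (subst form_commute[OF u w]) (simp add: form_def)
  then have "m * (\<integral>x. u x * w x \<partial>M) - form u w = (\<integral>x. m * (u x * w x) - w x * op u x \<partial>M)"
    using uw integrable_form[OF w u] by simp
  also have "\<dots> = ?N"
    by (intro Bochner_Integration.integral_cong refl) (simp add: w_def power2_eq_square algebra_simps)
  finally have polar: "m * (\<integral>x. u x * w x \<partial>M) - form u w = ?N" .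
  have le_w: "m * ?N - form w w \<le> c * ?N"
    using abs_form_le[OF w] by (simp add: c_def distrib_right)
  have "?N\<^sup>2 \<le> q * (m * ?N - form w w)"
  proof (rule quadratic_nonneg_imp_discriminant)
    fix t
    have "(\<integral>x. (u x - t * w x)\<^sup>2 \<partial>M) = (\<integral>x. (u x)\<^sup>2 - 2 * t * (u x * w x) + t\<^sup>2 * (w x)\<^sup>2 \<partial>M)"
      by (simp add: power2_diff power_mult_distrib algebra_simps)
    also have "\<dots> = (\<integral>x. (u x)\<^sup>2 \<partial>M) - 2 * t * (\<integral>x. u x * w x \<partial>M) + t\<^sup>2 * ?N"
      using uw by simp
    finally have "form (\<lambda>x. u x - t * w x) (\<lambda>x. u x - t * w x)
        \<le> m * ((\<integral>x. (u x)\<^sup>2 \<partial>M) - 2 * t * (\<integral>x. u x * w x \<partial>M) + t\<^sup>2 * ?N)"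
      using le[OF square_integrable_diff[OF u square_integrable_cmult[OF w, of t]]] by simp
    then show "0 \<le> q - 2 * t * ?N + t\<^sup>2 * (m * ?N - form w w)"
      unfolding form_diff_scale[OF u w] q_def polar[symmetric] by (simp add: algebra_simps)
  next
    show "0 \<le> m * ?N - form w w" using le[OF w] by simp
  qed
  also have "\<dots> \<le> q * (c * ?N)"
    using le_w le[OF u] by (intro mult_left_mono) (auto simp: q_def)
  finally have N: "?N * ?N \<le> c * q * ?N" by (simp add: power2_eq_square algebra_simps)
  have "?N \<le> c * q"
  proof (cases "?N = 0")
    case True
    have "0 \<le> c * q"
    proof (cases "\<integral>x. (u x)\<^sup>2 \<partial>M = 0")
      case True
      then show ?thesis using abs_form_le[OF u] by (simp add: q_def)
    next
      case False
      then have "0 < (\<integral>x. (u x)\<^sup>2 \<partial>M)" by (simp add: order_less_le)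
      moreover have "0 \<le> c * (\<integral>x. (u x)\<^sup>2 \<partial>M)"
        using le[OF u] abs_form_le[OF u] by (simp add: c_def distrib_right)
      ultimately have "0 \<le> c" by (simp add: zero_le_mult_iff)
      then show ?thesis using le[OF u] by (simp add: q_def)
    qed
    then show ?thesis using True by simp
  next
    case False
    then have "0 < ?N" by (simp add: order_less_le)
    then show ?thesis using N by simp
  qed
  then show ?thesis unfolding w_def c_def q_def .
qed

text \<open>
  Along a maximizing sequence the residuals $mu_n - Ku_n$ tend to $0$ in $L^2$. Compactness makes
  a subsequence of $Ku_n$ converge boundedly to some $g$, hence in $L^2$ by dominated convergence,
  and therefore $mu_n \to g$ in $L^2$ too. Since $K$ turns $L^2$ convergence into pointwise
  convergence, $Kg = \lim mKu_n = mg$. Positivity of the form somewhere gives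
  $m > 0$, which is what keeps $g$ from vanishing.
\<close>

theorem exists_maximal_eigenfunction:
  assumes compact: "\<And>U. (\<And>n::nat. U n \<in> square_integrable M \<and> (\<integral>x. (U n x)\<^sup>2 \<partial>M) = 1) \<Longrightarrow>
      \<exists>r g. strict_mono r \<and> (\<forall>x\<in>space M. (\<lambda>n. op (U (r n)) x) \<longlonglongrightarrow> g x)"
    and u0: "u0 \<in> square_integrable M" "form u0 u0 > 0"
  obtains m g where "g \<in> square_integrable M" "\<not> (AE x in M. g x = 0)"
    "\<And>x. x \<in> space M \<Longrightarrow> op g x = m * g x"
    "\<And>u. u \<in> square_integrable M \<Longrightarrow> form u u \<le> m * (\<integral>x. (u x)\<^sup>2 \<partial>M)"
proof -
  define S where "S = {form u u |u. u \<in> square_integrable M \<and> (\<integral>x. (u x)\<^sup>2 \<partial>M) = 1}"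
  define m where "m = Sup S"
  have bdd: "bdd_above S"
  proof (rule bdd_aboveI)
    show "s \<le> sqrt (measure M (space M) * C)" if "s \<in> S" for s
      using that abs_form_le by (fastforce simp: S_def)
  qed
  have normalised: "form u u / (\<integral>x. (u x)\<^sup>2 \<partial>M) \<in> S"
    if u: "u \<in> square_integrable M" and pos: "(\<integral>x. (u x)\<^sup>2 \<partial>M) > 0" for u
  proof -
    let ?N = "\<integral>x. (u x)\<^sup>2 \<partial>M"
    let ?w = "\<lambda>x. 1 / sqrt ?N * u x"
    have "(\<integral>x. (?w x)\<^sup>2 \<partial>M) = (\<integral>x. 1 / ?N * (u x)\<^sup>2 \<partial>M)"
      using pos by (intro Bochner_Integration.integral_cong refl)
        (simp add: power_mult_distrib power_divide)
    also have "\<dots> = 1 / ?N * ?N" by (rule integral_mult_right_zero)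
    finally have "(\<integral>x. (?w x)\<^sup>2 \<partial>M) = 1" using pos by simp
    moreover have "form ?w ?w = form u u / ?N"
      using pos unfolding form_scale by (simp add: power_divide)
    moreover have "?w \<in> square_integrable M" by (rule square_integrable_cmult[OF u])
    ultimately show ?thesis unfolding S_def by force
  qed
  have nz: "(\<integral>x. (u x)\<^sup>2 \<partial>M) > 0" if "u \<in> square_integrable M" "form u u > 0" for u
    using abs_form_le[OF that(1)] that(2) by (cases "(\<integral>x. (u x)\<^sup>2 \<partial>M) = 0") (auto simp: order_less_le)
  have S0: "form u0 u0 / (\<integral>x. (u0 x)\<^sup>2 \<partial>M) \<in> S"
    using normalised nz u0 by blast
  have "0 < form u0 u0 / (\<integral>x. (u0 x)\<^sup>2 \<partial>M)"
    using nz u0 by simp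
  also have "\<dots> \<le> m"
    unfolding m_def by (rule cSup_upper[OF S0 bdd])
  finally have m: "m > 0" .
  have le: "form u u \<le> m * (\<integral>x. (u x)\<^sup>2 \<partial>M)" if u: "u \<in> square_integrable M" for u
  proof (cases "form u u > 0")
    case True
    have "form u u / (\<integral>x. (u x)\<^sup>2 \<partial>M) \<le> m"
      unfolding m_def by (rule cSup_upper[OF normalised[OF u nz[OF u True]] bdd])
    then show ?thesis using nz[OF u True] by (simp add: field_simps)
  next
    case False
    then show ?thesis using m by (smt (verit) integral_nonneg zero_le_power2 mult_nonneg_nonneg integral_nonneg_AE AE_I2)
  qed
  have "\<exists>u. u \<in> square_integrable M \<and> (\<integral>x. (u x)\<^sup>2 \<partial>M) = 1 \<and> m - 1 / real (Suc n) < form u u" for n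
  proof -
    have "m - 1 / real (Suc n) < Sup S" by (simp add: m_def)
    then obtain s where "s \<in> S" "m - 1 / real (Suc n) < s"
      using S0 by (metis less_cSupD empty_iff)
    then show ?thesis by (auto simp: S_def)
  qed
  then obtain U where U: "\<And>n. U n \<in> square_integrable M" "\<And>n. (\<integral>x. (U n x)\<^sup>2 \<partial>M) = 1"
    "\<And>n. m - 1 / real (Suc n) < form (U n) (U n)"
    by metis
  obtain r g where r: "strict_mono r" and lim: "\<And>x. x \<in> space M \<Longrightarrow> (\<lambda>n. op (U (r n)) x) \<longlonglongrightarrow> g x"
    using compact[of U] U by blast
  define V where "V n = U (r n)" for n
  have V: "V n \<in> square_integrable M" "(\<integral>x. (V n x)\<^sup>2 \<partial>M) = 1" for n
    by (auto simp: V_def U)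
  have KV: "op (V n) \<in> square_integrable M" for n
    by (rule op_square_integrable[OF V(1)])
  have KV_le: "\<bar>op (V n) x\<bar> \<le> sqrt C" if "x \<in> space M" for n x
    using abs_op_le[OF V(1) that, of n] V(2) by simp
  have limV: "(\<lambda>n. op (V n) x) \<longlonglongrightarrow> g x" if "x \<in> space M" for x
    using lim[OF that] by (simp add: V_def)
  have [measurable]: "g \<in> borel_measurable M"
    by (rule borel_measurable_LIMSEQ_real[OF limV]) (use square_integrableD(1)[OF KV] in auto)
  have g_le: "\<bar>g x\<bar> \<le> sqrt C" if "x \<in> space M" for x
    by (rule LIMSEQ_le_const2[OF tendsto_rabs[OF limV[OF that]]]) (use KV_le that in auto)
  have g: "g \<in> square_integrable M"
    by (rule square_integrable_bounded[OF _ g_le]) auto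
  have residual: "(\<lambda>n. \<integral>x. (m * V n x - op (V n) x)\<^sup>2 \<partial>M) \<longlonglongrightarrow> 0"
  proof (rule real_tendsto_sandwich[where f = "\<lambda>_. 0"])
    let ?c = "m + sqrt (measure M (space M) * C)"
    have c: "?c \<ge> 0"
      using le[OF u0(1)] abs_form_le[OF u0(1)] nz[OF u0] m
      by (smt (verit) distrib_right zero_le_mult_iff)
    show "\<forall>\<^sub>F n in sequentially. (\<integral>x. (m * V n x - op (V n) x)\<^sup>2 \<partial>M) \<le> ?c * (1 / real (Suc n))"
    proof (rule always_eventually, rule allI)
      fix n
      have "n \<le> r n" using r by (rule seq_suble)
      then have "1 / real (Suc (r n)) \<le> 1 / real (Suc n)" by (simp add: field_simps)
      then have "m - form (V n) (V n) \<le> 1 / real (Suc n)"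
        using U(3)[of "r n"] by (simp add: V_def)
      then have "?c * (m * 1 - form (V n) (V n)) \<le> ?c * (1 / real (Suc n))"
        using c by (intro mult_left_mono) auto
      then show "(\<integral>x. (m * V n x - op (V n) x)\<^sup>2 \<partial>M) \<le> ?c * (1 / real (Suc n))"
        using residual_bound[OF le V(1), of n] V(2)[of n] by simp
    qed
    show "(\<lambda>n. ?c * (1 / real (Suc n))) \<longlonglongrightarrow> 0"
      using tendsto_mult_right_zero[OF LIMSEQ_inverse_real_of_nat, of ?c] by (simp add: inverse_eq_divide)
  qed auto
  have "(\<lambda>n. \<integral>x. (op (V n) x - g x)\<^sup>2 \<partial>M) \<longlonglongrightarrow> (\<integral>x. 0 \<partial>M)"
  proof (rule integral_dominated_convergence)
    show "AE x in M. (\<lambda>n. (op (V n) x - g x)\<^sup>2) \<longlonglongrightarrow> 0"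
    proof (rule AE_I2)
      fix x assume "x \<in> space M"
      then have "(\<lambda>n. (op (V n) x - g x)\<^sup>2) \<longlonglongrightarrow> (g x - g x)\<^sup>2"
        by (intro tendsto_intros limV)
      then show "(\<lambda>n. (op (V n) x - g x)\<^sup>2) \<longlonglongrightarrow> 0" by simp
    qed
    show "AE x in M. norm ((op (V n) x - g x)\<^sup>2) \<le> (2 * sqrt C)\<^sup>2" for n
    proof (rule AE_I2)
      fix x assume x: "x \<in> space M"
      have "\<bar>op (V n) x - g x\<bar> \<le> 2 * sqrt C"
        using KV_le[OF x, of n] g_le[OF x] by simp
      then have "\<bar>op (V n) x - g x\<bar>\<^sup>2 \<le> (2 * sqrt C)\<^sup>2" by (rule power_mono) simp
      then show "norm ((op (V n) x - g x)\<^sup>2) \<le> (2 * sqrt C)\<^sup>2" by simp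
    qed
  qed (use square_integrableD(1)[OF KV] in auto)
  then have KV_g: "(\<lambda>n. \<integral>x. (op (V n) x - g x)\<^sup>2 \<partial>M) \<longlonglongrightarrow> 0" by simp
  have mV: "(\<lambda>x. m * V n x) \<in> square_integrable M" for n
    by (rule square_integrable_cmult[OF V(1)])
  define e where "e n = (\<integral>x. (m * V n x - g x)\<^sup>2 \<partial>M)" for n
  have e: "e \<longlonglongrightarrow> 0"
  proof (rule real_tendsto_sandwich[where f = "\<lambda>_. 0"])
    show "\<forall>\<^sub>F n in sequentially. e n \<le> 2 * (\<integral>x. (m * V n x - op (V n) x)\<^sup>2 \<partial>M)
        + 2 * (\<integral>x. (op (V n) x - g x)\<^sup>2 \<partial>M)"
      unfolding e_def by (intro always_eventually allI integral_power2_diff_le mV KV g)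
    show "(\<lambda>n. 2 * (\<integral>x. (m * V n x - op (V n) x)\<^sup>2 \<partial>M)
        + 2 * (\<integral>x. (op (V n) x - g x)\<^sup>2 \<partial>M)) \<longlonglongrightarrow> 0"
      using tendsto_add[OF tendsto_mult_right_zero[OF residual, of 2] tendsto_mult_right_zero[OF KV_g, of 2]]
      by simp
  qed (auto simp: e_def)
  have eigen: "op g x = m * g x" if x: "x \<in> space M" for x
  proof -
    \<comment> \<open>This difference is the potential of \<open>m V\<^sub>n - g\<close>, which tends to zero in mean square.\<close>
    have "(\<lambda>n. m * op (V n) x - op g x) \<longlonglongrightarrow> 0"
    proof (rule tendsto_rabs_zero_cancel, rule real_tendsto_sandwich[where f = "\<lambda>_. 0"])
      have "m * op (V n) x - op g x = op (\<lambda>x. m * V n x - g x) x" for n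
        using op_add[OF mV square_integrable_cmult[OF g, of "-1"] x, of n]
        by (simp add: op_cmult[where c = m] op_cmult[where c = "-1", simplified])
      then show "\<forall>\<^sub>F n in sequentially. \<bar>m * op (V n) x - op g x\<bar> \<le> sqrt (C * e n)"
        unfolding e_def using abs_op_le[OF square_integrable_diff[OF mV g] x] by simp
      show "(\<lambda>n. sqrt (C * e n)) \<longlonglongrightarrow> 0"
        using tendsto_real_sqrt[OF tendsto_mult_right_zero[OF e, of C]] by simp
    qed auto
    moreover have "(\<lambda>n. m * op (V n) x - op g x) \<longlonglongrightarrow> m * g x - op g x"
      by (intro tendsto_intros limV x)
    ultimately show ?thesis using LIMSEQ_unique by fastforce
  qed
  have "\<not> (AE x in M. g x = 0)"
  proof
    assume "AE x in M. g x = 0"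
    then have g0: "(\<integral>x. (g x)\<^sup>2 \<partial>M) = 0"
      by (intro integral_eq_zero_AE) auto
    have "m\<^sup>2 \<le> 2 * e n" for n
    proof -
      have "m\<^sup>2 = (\<integral>x. m\<^sup>2 * (V n x)\<^sup>2 \<partial>M)" using V(2)[of n] by simp
      also have "\<dots> = (\<integral>x. (m * V n x - 0)\<^sup>2 \<partial>M)" by (simp add: power_mult_distrib)
      also have "\<dots> \<le> 2 * e n + 2 * (\<integral>x. (g x - 0)\<^sup>2 \<partial>M)"
        unfolding e_def by (rule integral_power2_diff_le) (use mV g square_integrable_bounded[of "\<lambda>_. 0" 0] in auto)
      finally show ?thesis using g0 by simp
    qed
    then have "m\<^sup>2 \<le> 0"
      by (intro LIMSEQ_le_const[OF tendsto_mult_right_zero[OF e, of 2]]) auto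
    then show False using m by simp
  qed
  then show ?thesis using that g eigen le by blast
qed

end

section \<open>The logarithmic kernel\<close>

text \<open>
  The part of the kernel lying above the level $\ln(1/\delta)$; by the convention for division by
  zero it takes the value $0$ at the origin.
\<close>

definition log_excess :: "real \<Rightarrow> real ^ 2 \<Rightarrow> real" where
  "log_excess \<delta> z = max 0 (ln (\<delta> / norm z))"

definition log_kernel :: "real ^ 2 \<Rightarrow> real ^ 2 \<Rightarrow> real" where
  "log_kernel x y = ln (1 / norm (x - y))"

text \<open>
  The layer-cake bound rests on $N^2 = 1 + 3 + \dots + (2N - 1)$: a square is
  dominated by a sum over the integer levels below its root.
\<close>

lemma power2_le_sum_odd:
  fixes t :: real
  assumes "0 \<le> t"
  shows "t\<^sup>2 \<le> (\<Sum>m | real m < t. real (2 * m + 1))"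
proof -
  define N where "N = nat \<lceil>t\<rceil>"
  have tN: "t \<le> real N" using assms by (simp add: N_def)
  have eq: "{m. real m < t} = {..<N}"
    using assms by (auto simp: N_def) linarith+
  have "(\<Sum>m<N. real (2 * m + 1)) = (real N)\<^sup>2" for N
    by (induction N) (auto simp: power2_eq_square algebra_simps)
  then show ?thesis
    unfolding eq using power_mono[OF tN assms, of 2] by simp
qed

lemma summable_odd_exp: "summable (\<lambda>m. real (2 * m + 1) * exp (- 2 * real m))"
proof (rule summable_comparison_test')
  show "summable (\<lambda>m. 2 * exp (- 1 :: real) ^ m)"
    by (intro summable_mult summable_geometric) simp
  fix m :: nat
  have "1 + real m \<le> exp (real m)" by (rule exp_ge_add_one_self)
  then have "real (2 * m + 1) \<le> 2 * exp (real m)" by linarith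
  then have "real (2 * m + 1) * exp (- 2 * real m) \<le> 2 * exp (real m) * exp (- 2 * real m)"
    by (rule mult_right_mono) simp
  also have "\<dots> = 2 * exp (- real m)" by (simp add: mult_exp_exp)
  also have "\<dots> = 2 * exp (- 1) ^ m" by (simp add: exp_of_nat_mult[symmetric])
  finally show "norm (real (2 * m + 1) * exp (- 2 * real m)) \<le> 2 * exp (- 1) ^ m"
    by simp
qed

text \<open>
  The odd weight $2m + 1$ is the increment of the squared level, and $\pi e^{-2m}$ is the area of
  the disc of radius $e^{-m}$ where the level $m$ is exceeded.
\<close>

definition layer_const :: real where
  "layer_const = pi * (\<Sum>m. real (2 * m + 1) * exp (- 2 * real m))"

lemma layer_const_nonneg: "0 \<le> layer_const"
  unfolding layer_const_def by (intro mult_nonneg_nonneg suminf_nonneg summable_odd_exp) auto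

text \<open>
  The level $m$ of \<open>log_excess \<delta>\<close> is exceeded on the disc of radius $\delta e^{-m}$.
  Summing the areas of these discs gives the factor \<open>\<delta>\<^sup>2\<close> that the continuity estimate
  for potentials relies on.
\<close>

lemma nn_integral_log_excess:
  assumes \<delta>: "\<delta> > 0"
  shows "(\<integral>\<^sup>+y. ennreal ((log_excess \<delta> (x - y))\<^sup>2) \<partial>lborel) \<le> ennreal (layer_const * \<delta>\<^sup>2)"
proof -
  let ?B = "\<lambda>m::nat. ball x (\<delta> * exp (- real m))"
  let ?c = "\<lambda>m::nat. real (2 * m + 1) * exp (- 2 * real m)"
  have layers: "ennreal ((log_excess \<delta> (x - y))\<^sup>2) \<le> (\<Sum>m. ennreal (real (2 * m + 1)) * indicator (?B m) y)"
    if y: "y \<noteq> x" for y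
  proof -
    define t where "t = log_excess \<delta> (x - y)"
    have t0: "t \<ge> 0" by (simp add: t_def log_excess_def)
    have fin: "finite {m. real m < t}"
      by (rule finite_subset[of _ "{..nat \<lceil>t\<rceil>}"]) (auto, linarith)
    have "ennreal (t\<^sup>2) \<le> (\<Sum>m | real m < t. ennreal (real (2 * m + 1)))"
      using power2_le_sum_odd[OF t0] by (subst sum_ennreal) (auto intro: ennreal_leI)
    also have "\<dots> \<le> (\<Sum>m | real m < t. ennreal (real (2 * m + 1)) * indicator (?B m) y)"
    proof (rule sum_mono)
      fix m assume "m \<in> {m. real m < t}"
      then have "real m < ln (\<delta> / norm (x - y))"
        by (auto simp: t_def log_excess_def split: if_splits)
      then have "exp (real m) < \<delta> / norm (x - y)"
        using y \<delta> by (subst (asm) exp_less_cancel_iff[symmetric]) simp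
      then have "norm (x - y) < \<delta> * exp (- real m)"
        using y by (simp add: exp_minus field_simps)
      then show "ennreal (real (2 * m + 1)) \<le> ennreal (real (2 * m + 1)) * indicator (?B m) y"
        by (simp add: dist_norm)
    qed
    also have "\<dots> \<le> (\<Sum>m. ennreal (real (2 * m + 1)) * indicator (?B m) y)"
      by (rule sum_le_suminf) (use fin in auto)
    finally show ?thesis by (simp add: t_def)
  qed
  have [measurable]: "?B m \<in> sets borel" for m by simp
  have layer_sum: "(\<integral>\<^sup>+y. (\<Sum>m. c m * indicator (?B m) y) \<partial>lborel) = (\<Sum>m. c m * emeasure lborel (?B m))"
    for c :: "nat \<Rightarrow> ennreal"
    by (subst nn_integral_suminf, measurable) (simp add: nn_integral_cmult_indicator)
  have "(\<integral>\<^sup>+y. ennreal ((log_excess \<delta> (x - y))\<^sup>2) \<partial>lborel)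
      \<le> (\<integral>\<^sup>+y. (\<Sum>m. ennreal (real (2 * m + 1)) * indicator (?B m) y) \<partial>lborel)"
    using AE_lborel_singleton[of x] layers by (intro nn_integral_mono_AE) (auto elim!: eventually_mono)
  also have "\<dots> = (\<Sum>m. ennreal (real (2 * m + 1)) * emeasure lborel (?B m))"
    by (rule layer_sum)
  also have "\<dots> = (\<Sum>m. ennreal (pi * \<delta>\<^sup>2 * ?c m))"
  proof (rule suminf_cong)
    fix m :: nat
    have "emeasure lborel (?B m) = ennreal (pi * (\<delta> * exp (- real m))\<^sup>2)"
      using \<delta> by (subst emeasure_ball) (auto simp: unit_ball_vol_2)
    also have "(\<delta> * exp (- real m))\<^sup>2 = \<delta>\<^sup>2 * exp (- 2 * real m)"
      by (simp add: power_mult_distrib exp_double[symmetric])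
    finally have "ennreal (real (2 * m + 1)) * emeasure lborel (?B m)
        = ennreal (real (2 * m + 1) * (pi * (\<delta>\<^sup>2 * exp (- 2 * real m))))"
      using ennreal_mult[of "real (2 * m + 1)" "pi * (\<delta>\<^sup>2 * exp (- 2 * real m))"] by simp
    also have "real (2 * m + 1) * (pi * (\<delta>\<^sup>2 * exp (- 2 * real m))) = pi * \<delta>\<^sup>2 * ?c m"
      by (simp only: mult_ac)
    finally show "ennreal (real (2 * m + 1)) * emeasure lborel (?B m) = ennreal (pi * \<delta>\<^sup>2 * ?c m)" .
  qed
  also have "\<dots> = ennreal (\<Sum>m. pi * \<delta>\<^sup>2 * ?c m)"
    by (rule suminf_ennreal2) (simp, rule summable_mult[OF summable_odd_exp])
  also have "(\<Sum>m. pi * \<delta>\<^sup>2 * ?c m) = layer_const * \<delta>\<^sup>2"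
    by (subst suminf_mult[OF summable_odd_exp]) (simp add: layer_const_def)
  finally show ?thesis .
qed

lemma borel_measurable_lebesgue_on_of_borel:
  fixes f :: "'a::euclidean_space \<Rightarrow> 'b::topological_space"
  assumes "f \<in> borel_measurable borel"
  shows "f \<in> borel_measurable (lebesgue_on S)"
  using assms by (intro measurable_restrict_space1 measurable_completion) simp

lemma log_excess_square_integrable:
  assumes S: "S \<in> sets lebesgue" and \<delta>: "\<delta> > 0"
  shows "(\<lambda>y. log_excess \<delta> (x - y)) \<in> square_integrable (lebesgue_on S)" (is ?thesis1)
    and "(\<integral>y. (log_excess \<delta> (x - y))\<^sup>2 \<partial>lebesgue_on S) \<le> layer_const * \<delta>\<^sup>2" (is ?thesis2)
proof -
  let ?f = "\<lambda>y. log_excess \<delta> (x - y)"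
  have [measurable]: "?f \<in> borel_measurable (lebesgue_on S)"
    unfolding log_excess_def[abs_def] by (intro borel_measurable_lebesgue_on_of_borel) measurable
  have "(\<integral>\<^sup>+y. ennreal ((?f y)\<^sup>2) \<partial>lebesgue_on S) = (\<integral>\<^sup>+y. ennreal ((?f y)\<^sup>2) * indicator S y \<partial>lebesgue)"
    using S by (subst nn_integral_restrict_space) auto
  also have "\<dots> \<le> (\<integral>\<^sup>+y. ennreal ((?f y)\<^sup>2) \<partial>lebesgue)"
    by (intro nn_integral_mono) (simp split: split_indicator)
  also have "\<dots> \<le> ennreal (layer_const * \<delta>\<^sup>2)"
    using nn_integral_log_excess[OF \<delta>] by (simp add: nn_integral_completion)
  finally have le: "(\<integral>\<^sup>+y. ennreal ((?f y)\<^sup>2) \<partial>lebesgue_on S) \<le> ennreal (layer_const * \<delta>\<^sup>2)" .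
  have "integrable (lebesgue_on S) (\<lambda>y. (?f y)\<^sup>2)"
    by (rule integrableI_bounded) (use le in \<open>auto intro: le_less_trans\<close>)
  then show ?thesis1 by (simp add: square_integrable_def)
  show ?thesis2
    using le layer_const_nonneg by (intro integral_real_bounded) auto
qed

text \<open>
  The points must be distinct: on the diagonal the kernel has the default value \<open>0\<close>, while the
  truncated kernel has the value $-\ln\delta$.
\<close>

lemma log_kernel_decompose:
  assumes "\<delta> > 0" "y \<noteq> x"
  shows "log_kernel x y = log_excess \<delta> (x - y) - ln (max \<delta> (norm (x - y)))"
  using assms unfolding log_kernel_def log_excess_def
  by (cases "\<delta> \<le> norm (x - y)") (auto simp: max_def ln_div not_le)

lemma AE_lebesgue_on_neq:
  assumes "S \<in> sets lebesgue"
  shows "AE y in lebesgue_on S. y \<noteq> (x :: 'a::euclidean_space)"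
  using assms AE_completion[OF AE_lborel_singleton[of x]]
  by (subst AE_restrict_space_iff) (auto elim: eventually_mono)

lemma borel_measurable_log_kernel: "log_kernel x \<in> borel_measurable (lebesgue_on S)"
  unfolding log_kernel_def[abs_def] by (intro borel_measurable_lebesgue_on_of_borel) measurable

lemma log_kernel_square_integrable:
  assumes S: "S \<in> lmeasurable" and R: "S \<subseteq> cball 0 R" "x \<in> cball 0 R"
  shows "log_kernel x \<in> square_integrable (lebesgue_on S)" (is ?thesis1)
    and "(\<integral>y. (log_kernel x y)\<^sup>2 \<partial>lebesgue_on S) \<le> 2 * layer_const + 8 * R\<^sup>2 * measure lebesgue S" (is ?thesis2)
proof -
  interpret finite_measure "lebesgue_on S" by (rule finite_measure_lebesgue_on[OF S])
  have S': "S \<in> sets lebesgue" using S by (simp add: fmeasurableD)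
  note excess = log_excess_square_integrable[OF S', of 1 x]
  let ?b = "\<lambda>y. 2 * (log_excess 1 (x - y))\<^sup>2 + 2 * (2 * R)\<^sup>2"
  have int: "integrable (lebesgue_on S) ?b"
    using square_integrableD(2)[OF excess(1)] by simp
  have "(log_kernel x y)\<^sup>2 \<le> ?b y" if "y \<in> S" "y \<noteq> x" for y
  proof -
    let ?r = "norm (x - y)"
    have r: "?r \<le> 2 * R"
      using norm_triangle_ineq4[of x y] R that by (auto simp: subset_iff)
    have "ln (max 1 ?r) \<le> max 1 ?r - 1" "0 \<le> ln (max 1 ?r)"
      by (rule ln_le_minus_one) auto
    then have "\<bar>ln (max 1 ?r)\<bar> \<le> 2 * R"
      using r norm_ge_zero[of "x - y"] by linarith
    then have "(ln (max 1 ?r))\<^sup>2 \<le> (2 * R)\<^sup>2"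
      using power_mono[of "\<bar>ln (max 1 ?r)\<bar>" "2 * R" 2] by simp
    then show ?thesis
      using power2_add_le[of "log_excess 1 (x - y)" "- ln (max 1 ?r)"]
      by (simp add: log_kernel_decompose[of 1 y x] that)
  qed
  note le = this
  have AE: "AE y in lebesgue_on S. (log_kernel x y)\<^sup>2 \<le> ?b y"
    using AE_lebesgue_on_neq[OF S', of x] by (rule AE_mp) (use le in \<open>auto intro!: AE_I2 simp: space_restrict_space\<close>)
  have int2: "integrable (lebesgue_on S) (\<lambda>y. (log_kernel x y)\<^sup>2)"
  proof (rule Bochner_Integration.integrable_bound[OF int])
    show "AE y in lebesgue_on S. norm ((log_kernel x y)\<^sup>2) \<le> norm (?b y)"
      using AE by eventually_elim simp
  qed (use borel_measurable_log_kernel in simp)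
  then show ?thesis1
    using borel_measurable_log_kernel by (simp add: square_integrable_def)
  have "(\<integral>y. (log_kernel x y)\<^sup>2 \<partial>lebesgue_on S) \<le> integral\<^sup>L (lebesgue_on S) ?b"
    by (rule integral_mono_AE[OF int2 int AE])
  also have "\<dots> = 2 * (\<integral>y. (log_excess 1 (x - y))\<^sup>2 \<partial>lebesgue_on S) + 2 * (2 * R)\<^sup>2 * measure lebesgue S"
    using square_integrableD(2)[OF excess(1)] S'
    by (simp add: measure_restrict_space space_restrict_space)
  also have "\<dots> \<le> 2 * layer_const + 8 * R\<^sup>2 * measure lebesgue S"
    using excess(2) by (simp add: power_mult_distrib)
  finally show ?thesis2 .
qed

lemma abs_ln_diff_le:
  fixes p q :: real
  assumes "0 < \<delta>" "\<delta> \<le> p" "\<delta> \<le> q"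
  shows "\<bar>ln p - ln q\<bar> \<le> \<bar>p - q\<bar> / \<delta>"
proof -
  have *: "ln p - ln q \<le> \<bar>p - q\<bar> / \<delta>" if "\<delta> \<le> p" "\<delta> \<le> q" for p q
  proof -
    have "ln p - ln q \<le> (p - q) / q" using that assms(1) by (intro ln_diff_le) auto
    also have "\<dots> \<le> \<bar>p - q\<bar> / \<delta>" using that assms(1) by (intro frac_le) auto
    finally show ?thesis .
  qed
  show ?thesis using *[of p q] *[of q p] assms by (simp add: abs_le_iff abs_minus_commute)
qed

text \<open>
  Truncate both kernels at scale \<open>\<delta>\<close>. The excesses cost $O(\delta^2)$, and the truncated
  kernels are $1/\delta$-Lipschitz, which costs $|x - x'|^2/\delta^2$. Both costs are of order
  $|x - x'|$ for $\delta^2 = |x - x'|$.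
\<close>

lemma log_kernel_translation_estimate:
  assumes S: "S \<in> lmeasurable" and ne: "x \<noteq> x'"
  shows "(\<integral>y. (log_kernel x y - log_kernel x' y)\<^sup>2 \<partial>lebesgue_on S)
    \<le> 3 * (2 * layer_const + measure lebesgue S) * norm (x - x')"
proof -
  interpret finite_measure "lebesgue_on S" by (rule finite_measure_lebesgue_on[OF S])
  have S': "S \<in> sets lebesgue" using S by (simp add: fmeasurableD)
  \<comment> \<open>This choice balances the truncation error against the Lipschitz error.\<close>
  define \<delta> where "\<delta> = sqrt (norm (x - x'))"
  have \<delta>: "\<delta> > 0" "\<delta>\<^sup>2 = norm (x - x')" using ne by (auto simp: \<delta>_def)
  note excess = log_excess_square_integrable[OF S' \<delta>(1)]
  let ?b = "\<lambda>y. 3 * ((log_excess \<delta> (x - y))\<^sup>2 + (log_excess \<delta> (x' - y))\<^sup>2 + \<delta>\<^sup>2)"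
  have int: "integrable (lebesgue_on S) ?b"
    using square_integrableD(2)[OF excess(1)] by simp
  have sum3: "(a + b + c)\<^sup>2 \<le> 3 * (a\<^sup>2 + b\<^sup>2 + c\<^sup>2)" for a b c :: real
    using zero_le_power2[of "a - b"] zero_le_power2[of "a - c"] zero_le_power2[of "b - c"]
    by (simp add: power2_eq_square algebra_simps)
  have le: "(log_kernel x y - log_kernel x' y)\<^sup>2 \<le> ?b y" if "y \<noteq> x" "y \<noteq> x'" for y
  proof -
    let ?l = "ln (max \<delta> (norm (x' - y))) - ln (max \<delta> (norm (x - y)))"
    have "\<bar>max \<delta> (norm (x' - y)) - max \<delta> (norm (x - y))\<bar> \<le> norm (x - x')"
      using norm_triangle_ineq3[of "x' - y" "x - y"] by (auto simp: norm_minus_commute max_def)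
    then have "\<bar>?l\<bar> \<le> norm (x - x') / \<delta>"
      using abs_ln_diff_le[OF \<delta>(1), of "max \<delta> (norm (x' - y))" "max \<delta> (norm (x - y))"] \<delta>(1)
      by (smt (verit) divide_right_mono max.cobounded1)
    also have "\<dots> = \<delta>" using \<delta> by (simp add: power2_eq_square field_simps)
    finally have "?l\<^sup>2 \<le> \<delta>\<^sup>2"
      using power_mono[of "\<bar>?l\<bar>" \<delta> 2] by simp
    then show ?thesis
      using sum3[of "log_excess \<delta> (x - y)" "- log_excess \<delta> (x' - y)" ?l]
      by (simp add: log_kernel_decompose[OF \<delta>(1)] that algebra_simps)
  qed
  have AE: "AE y in lebesgue_on S. (log_kernel x y - log_kernel x' y)\<^sup>2 \<le> ?b y"
    using AE_lebesgue_on_neq[OF S', of x] AE_lebesgue_on_neq[OF S', of x']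
    by eventually_elim (rule le)
  have "(\<integral>y. (log_kernel x y - log_kernel x' y)\<^sup>2 \<partial>lebesgue_on S) \<le> integral\<^sup>L (lebesgue_on S) ?b"
  proof (rule integral_mono_AE[OF _ int AE])
    show "integrable (lebesgue_on S) (\<lambda>y. (log_kernel x y - log_kernel x' y)\<^sup>2)"
    proof (rule Bochner_Integration.integrable_bound[OF int])
      show "AE y in lebesgue_on S. norm ((log_kernel x y - log_kernel x' y)\<^sup>2) \<le> norm (?b y)"
        using AE by eventually_elim simp
    qed (use borel_measurable_log_kernel in simp)
  qed
  also have "\<dots> = 3 * ((\<integral>y. (log_excess \<delta> (x - y))\<^sup>2 \<partial>lebesgue_on S)
      + (\<integral>y. (log_excess \<delta> (x' - y))\<^sup>2 \<partial>lebesgue_on S) + \<delta>\<^sup>2 * measure lebesgue S)"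
    using square_integrableD(2)[OF excess(1)] S'
    by (simp add: measure_restrict_space space_restrict_space)
  also have "\<dots> \<le> 3 * (2 * layer_const + measure lebesgue S) * \<delta>\<^sup>2"
    using excess(2)[of x] excess(2)[of x'] by (simp add: algebra_simps)
  finally show ?thesis unfolding \<delta>(2) .
qed

lemma symmetric_kernel_log_kernel:
  assumes S: "S \<in> lmeasurable" and R: "S \<subseteq> cball 0 R"
  shows "symmetric_kernel (lebesgue_on S) log_kernel (2 * layer_const + 8 * R\<^sup>2 * measure lebesgue S)"
proof -
  interpret finite_measure "lebesgue_on S" by (rule finite_measure_lebesgue_on[OF S])
  have id: "(\<lambda>x. x) \<in> borel_measurable (lebesgue_on S)"
    by (intro borel_measurable_lebesgue_on_of_borel) simp
  show ?thesis
  proof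
    note [measurable] = measurable_compose[OF measurable_fst id] measurable_compose[OF measurable_snd id]
    show "(\<lambda>(x, y). log_kernel x y) \<in> borel_measurable (lebesgue_on S \<Otimes>\<^sub>M lebesgue_on S)"
      unfolding log_kernel_def case_prod_beta by measurable
    show "log_kernel x \<in> square_integrable (lebesgue_on S)"
      "(\<integral>y. (log_kernel x y)\<^sup>2 \<partial>lebesgue_on S) \<le> 2 * layer_const + 8 * R\<^sup>2 * measure lebesgue S"
      if "x \<in> space (lebesgue_on S)" for x
      using that R log_kernel_square_integrable[OF S R, of x] by (auto simp: space_restrict_space)
    show "log_kernel x y = log_kernel y x" for x y
      by (simp add: log_kernel_def norm_minus_commute)
  qed
qed

text \<open>
  By the translation estimate the potentials of the unit ball of $L^2$ are uniformly Hoelder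
  continuous with exponent $1/2$, so the Arzela--Ascoli theorem applies. It is used on a closed
  disc, where the potentials are defined and bounded as well.
\<close>

lemma log_potential_compact:
  fixes U :: "nat \<Rightarrow> real ^ 2 \<Rightarrow> real"
  assumes S: "S \<in> lmeasurable" and R: "S \<subseteq> cball 0 R"
    and U: "\<And>n. U n \<in> square_integrable (lebesgue_on S)"
    and norm1: "\<And>n. (\<integral>x. (U n x)\<^sup>2 \<partial>lebesgue_on S) = 1"
  obtains r g where "strict_mono r"
    "\<And>x. x \<in> S \<Longrightarrow> (\<lambda>n. \<integral>y. log_kernel x y * U (r n) y \<partial>lebesgue_on S) \<longlonglongrightarrow> g x"
proof -
  define F where "F n x = (\<integral>y. log_kernel x y * U n y \<partial>lebesgue_on S)" for n x
  define A where "A = 3 * (2 * layer_const + measure lebesgue S)"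
  have A: "A \<ge> 0" using layer_const_nonneg by (simp add: A_def)
  note sq = log_kernel_square_integrable[OF S R]
  have holder: "\<bar>F n x - F n x'\<bar> \<le> sqrt (A * norm (x - x'))" if x: "x \<in> cball 0 R" "x' \<in> cball 0 R" for n x x'
  proof (cases "x = x'")
    case False
    have "F n x - F n x' = (\<integral>y. (log_kernel x y - log_kernel x' y) * U n y \<partial>lebesgue_on S)"
      unfolding F_def left_diff_distrib
      using integrable_mult_square_integrable[OF sq(1) U] x by simp
    also have "\<bar>\<dots>\<bar> \<le> sqrt (A * norm (x - x') * (\<integral>y. (U n y)\<^sup>2 \<partial>lebesgue_on S))"
      using log_kernel_translation_estimate[OF S False] unfolding A_def
      by (intro abs_integral_mult_le_sqrt square_integrable_diff sq x U)
    finally show ?thesis by (simp add: norm1)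
  qed simp
  have bound: "norm (F n x) \<le> sqrt (2 * layer_const + 8 * R\<^sup>2 * measure lebesgue S)"
    if x: "x \<in> cball 0 R" for n x
    using abs_integral_mult_le_sqrt[OF sq(1)[OF x] U sq(2)[OF x], of n] by (simp add: F_def norm1)
  obtain g and r :: "nat \<Rightarrow> nat" where r: "strict_mono r"
    and g: "\<And>e. 0 < e \<Longrightarrow> \<exists>N. \<forall>n x. n \<ge> N \<and> x \<in> cball 0 R \<longrightarrow> norm (F (r n) x - g x) < e"
  proof (rule Arzela_Ascoli[of "cball 0 R" F])
    show "compact (cball 0 R :: (real ^ 2) set)" by simp
    show "norm (F n x) \<le> sqrt (2 * layer_const + 8 * R\<^sup>2 * measure lebesgue S)" if "x \<in> cball 0 R" for n x
      by (rule bound[OF that])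
    show "\<exists>d>0. \<forall>n y. y \<in> cball 0 R \<and> norm (x - y) < d \<longrightarrow> norm (F n x - F n y) < e"
      if x: "x \<in> cball 0 R" and e: "0 < e" for x e
    proof (intro exI conjI allI impI)
      show "0 < e\<^sup>2 / (A + 1)" using e A by simp
      fix n y assume y: "y \<in> cball 0 R \<and> norm (x - y) < e\<^sup>2 / (A + 1)"
      have "A * norm (x - y) \<le> (A + 1) * norm (x - y)" by (simp add: distrib_right)
      also have "\<dots> < e\<^sup>2" using y A by (simp add: field_simps)
      finally have "sqrt (A * norm (x - y)) < e" using e by (simp add: real_less_lsqrt)
      then show "norm (F n x - F n y) < e" using holder[OF x, of y n] y by simp
    qed
  qed blast
  have "(\<lambda>n. F (r n) x) \<longlonglongrightarrow> g x" if "x \<in> S" for x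
    using g that R by (intro LIMSEQ_I) blast
  then show ?thesis
    by (intro that[OF r, of g]) (simp add: F_def)
qed

section \<open>The variational principle for the largest eigenvalue\<close>

lemma log_potential_eq:
  "log_potential S u x = 1 / (2 * pi) * (\<integral>y. log_kernel x y * u y \<partial>lebesgue_on S)"
  by (simp add: log_potential_def log_kernel_def)

lemma L2_on_eq: "L2_on S = square_integrable (lebesgue_on S)"
  by (auto simp: L2_on_def square_integrable_def)

text \<open>
  The eigenfunction attaining the maximal Rayleigh quotient shows that this maximum is an
  eigenvalue, and every eigenvalue is the Rayleigh quotient of its eigenfunction. So the greatest
  eigenvalue exists and is this maximum. Although the kernel changes sign on sets of diameter more
  than $1$, the form is positive on the indicator of a small disc, so the maximum is positive.
\<close>

theorem log_form_le_tau1: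
  assumes open_S: "open S" and bdd: "bounded S" and ne: "S \<noteq> {}"
    and u: "u \<in> square_integrable (lebesgue_on S)"
  shows "(\<integral>x. u x * log_potential S u x \<partial>lebesgue_on S) \<le> tau1 S * (\<integral>x. (u x)\<^sup>2 \<partial>lebesgue_on S)"
proof -
  have S: "S \<in> lmeasurable" using open_S bdd by (rule lmeasurable_open[rotated])
  obtain R where R: "S \<subseteq> cball 0 R" 
    using bounded_subset_ballD[OF bdd, of 0] ball_subset_cball by blast
  interpret symmetric_kernel "lebesgue_on S" log_kernel "2 * layer_const + 8 * R\<^sup>2 * measure lebesgue S"
    by (rule symmetric_kernel_log_kernel[OF S R])
  have pot: "log_potential S w x = 1 / (2 * pi) * op w x" for w x
    by (simp add: log_potential_eq op_def)
  have sp: "space (lebesgue_on S) = S" by (simp add: space_restrict_space)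
  obtain x0 where x0: "x0 \<in> S" using ne by blast
  obtain \<rho>' where \<rho>': "\<rho>' > 0" "ball x0 \<rho>' \<subseteq> S" using open_S x0 by (meson open_contains_ball)
  \<comment> \<open>With this radius the points of the disc are at distances below \<open>1/2\<close>,
    so the kernel is at least \<open>ln 2\<close> for any two distinct ones.\<close>
  define \<rho> where "\<rho> = min \<rho>' (1 / 4)"
  let ?B = "ball x0 \<rho>"
  have \<rho>: "\<rho> > 0" "?B \<subseteq> S" "\<rho> \<le> 1 / 4" using \<rho>' by (auto simp: \<rho>_def)
  define u0 where "u0 = (indicator ?B :: real ^ 2 \<Rightarrow> real)"
  have u0: "u0 \<in> square_integrable (lebesgue_on S)"
    unfolding u0_def
  proof (rule square_integrable_bounded[of _ 1])
    show "(indicator ?B :: real ^ 2 \<Rightarrow> real) \<in> borel_measurable (lebesgue_on S)"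
      by (intro borel_measurable_lebesgue_on_of_borel borel_measurable_indicator) simp
  qed (simp split: split_indicator)
  have I: "(\<integral>x. u0 x \<partial>lebesgue_on S) > 0"
  proof -
    have "(\<integral>x. u0 x \<partial>lebesgue_on S) = measure (lebesgue_on S) ?B"
      unfolding u0_def using \<rho>(2) sp by (simp add: Int_absorb2)
    also have "\<dots> = measure lebesgue ?B"
      using \<rho>(2) S by (intro measure_restrict_space) (auto simp: fmeasurableD)
    also have "\<dots> > 0" using content_ball_pos[OF \<rho>(1), of x0] by simp
    finally show ?thesis .
  qed
  let ?I = "\<integral>x. u0 x \<partial>lebesgue_on S"
  have op_ge: "ln 2 * ?I \<le> op u0 x" if x: "x \<in> ?B" for x
  proof -
    have xS: "x \<in> space (lebesgue_on S)" using x \<rho>(2) sp by blast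
    have "ln 2 * u0 y \<le> log_kernel x y * u0 y" if "y \<noteq> x" for y
    proof (cases "y \<in> ?B")
      case True
      have "norm (x - y) < 1 / 2"
        using dist_triangle2[of x y x0] x True \<rho>(3) by (simp add: dist_norm norm_minus_commute)
      then have "2 \<le> 1 / norm (x - y)" using that by (simp add: field_simps)
      then have "ln 2 \<le> ln (1 / norm (x - y))"
        using that by (subst ln_le_cancel_iff) auto
      then show ?thesis using True by (simp add: u0_def log_kernel_def)
    qed (simp add: u0_def)
    then have "AE y in lebesgue_on S. ln 2 * u0 y \<le> log_kernel x y * u0 y"
      using AE_lebesgue_on_neq[of S x] S by (auto simp: fmeasurableD elim: eventually_mono)
    then have "(\<integral>y. ln 2 * u0 y \<partial>lebesgue_on S) \<le> op u0 x"
      unfolding op_def using square_integrable_imp_integrable[OF u0] integrable_kernel[OF u0 xS]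
      by (intro integral_mono_AE) auto
    then show ?thesis by simp
  qed
  have "(\<integral>x. ln 2 * ?I * u0 x \<partial>lebesgue_on S) \<le> form u0 u0"
    unfolding form_def
  proof (rule integral_mono)
    show "ln 2 * ?I * u0 x \<le> u0 x * op u0 x" for x
      using op_ge[of x] by (cases "x \<in> ?B") (auto simp: u0_def)
  qed (use square_integrable_imp_integrable[OF u0] integrable_form[OF u0 u0] in auto)
  moreover have "0 < ln 2 * ?I * ?I" using I by simp
  ultimately have pos: "form u0 u0 > 0" by simp
  obtain m g where g: "g \<in> square_integrable (lebesgue_on S)" "\<not> (AE x in lebesgue_on S. g x = 0)"
    "\<And>x. x \<in> space (lebesgue_on S) \<Longrightarrow> op g x = m * g x"
    and le: "\<And>w. w \<in> square_integrable (lebesgue_on S) \<Longrightarrow> form w w \<le> m * (\<integral>x. (w x)\<^sup>2 \<partial>lebesgue_on S)"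
  proof (rule exists_maximal_eigenfunction[OF _ u0 pos])
    show "\<exists>r g. strict_mono r \<and> (\<forall>x\<in>space (lebesgue_on S). (\<lambda>n. op (U (r n)) x) \<longlonglongrightarrow> g x)"
      if "\<And>n::nat. U n \<in> square_integrable (lebesgue_on S) \<and> (\<integral>x. (U n x)\<^sup>2 \<partial>lebesgue_on S) = 1" for U
      using log_potential_compact[OF S R, of U] that unfolding sp op_def by metis
  qed blast
  have "tau1 S = m / (2 * pi)"
    unfolding tau1_def
  proof (rule Greatest_equality)
    have "log_eigenfunction S (m / (2 * pi)) g"
      unfolding log_eigenfunction_def L2_on_eq
    proof (intro conjI g)
      show "AE x in lebesgue_on S. log_potential S g x = m / (2 * pi) * g x"
        by (rule AE_I2) (simp add: pot g)
    qed
    then show "log_eigenvalue S (m / (2 * pi))"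
      by (auto simp: log_eigenvalue_def)
  next
    fix \<tau> assume "log_eigenvalue S \<tau>"
    then obtain w where w: "w \<in> square_integrable (lebesgue_on S)"
      "\<not> (AE x in lebesgue_on S. w x = 0)" "AE x in lebesgue_on S. log_potential S w x = \<tau> * w x"
      by (auto simp: log_eigenvalue_def log_eigenfunction_def L2_on_eq)
    have "form w w = (\<integral>x. 2 * pi * \<tau> * (w x)\<^sup>2 \<partial>lebesgue_on S)"
      unfolding form_def
    proof (rule integral_cong_AE)
      show "AE x in lebesgue_on S. w x * op w x = 2 * pi * \<tau> * (w x)\<^sup>2"
        using w(3) by eventually_elim (simp add: pot field_simps power2_eq_square)
    qed (use w(1) square_integrableD[OF w(1)] measurable_op in auto)
    then have "2 * pi * \<tau> * (\<integral>x. (w x)\<^sup>2 \<partial>lebesgue_on S) \<le> m * (\<integral>x. (w x)\<^sup>2 \<partial>lebesgue_on S)"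
      using le[OF w(1)] by simp
    then show "\<tau> \<le> m / (2 * pi)"
      using not_AE_zero_imp_integral_pos[OF w(1,2)] by (simp add: field_simps)
  qed
  moreover have "(\<integral>x. u x * log_potential S u x \<partial>lebesgue_on S) = form u u / (2 * pi)"
    by (simp add: pot form_def)
  ultimately show ?thesis
    using divide_right_mono[OF le[OF u], of "2 * pi"] by simp
qed

section \<open>Polarization of functions\<close>

text \<open>
  The measure-theoretic content of a reflection that preserves the kernel and exchanges the two
  sides of a half-space. Off the fixed points exactly one of \<open>x\<close> and \<open>\<sigma> x\<close> lies in \<open>H\<close>, and
  \<open>kernel_less\<close> says that points on the same side interact more strongly. The strict inequality
  is asked for distinct points only, since a kernel that is singular on the diagonal has
  an arbitrary finite value there; the pairs left out are null by \<open>AE_off_diagonal\<close>.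
\<close>

locale reflection_kernel = symmetric_kernel +
  fixes \<sigma> :: "'a \<Rightarrow> 'a" and H :: "'a set"
  assumes reflect_measurable [measurable]: "\<sigma> \<in> measurable M M"
    and distr_reflect: "distr M M \<sigma> = M"
    and reflect_reflect [simp]: "\<sigma> (\<sigma> x) = x"
    and kernel_reflect: "k (\<sigma> x) (\<sigma> y) = k x y"
    and H_measurable [measurable]: "Measurable.pred M (\<lambda>x. x \<in> H)"
    and reflect_not_in: "x \<in> H \<Longrightarrow> \<sigma> x \<notin> H"
    and reflect_fixed: "x \<notin> H \<Longrightarrow> \<sigma> x \<notin> H \<Longrightarrow> \<sigma> x = x"
    and kernel_less: "x \<in> H \<Longrightarrow> y \<in> H \<Longrightarrow> x \<noteq> y \<Longrightarrow> k x (\<sigma> y) < k x y"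
    and AE_off_diagonal: "AE (x, y) in M \<Otimes>\<^sub>M M. x \<noteq> y \<and> x \<noteq> \<sigma> y"
begin

lemma reflect_in_space: "x \<in> space M \<Longrightarrow> \<sigma> x \<in> space M"
  using measurable_space[OF reflect_measurable] .

lemma integral_reflect:
  fixes h :: "'a \<Rightarrow> real"
  assumes "h \<in> borel_measurable M"
  shows "(\<integral>x. h (\<sigma> x) \<partial>M) = (\<integral>x. h x \<partial>M)"
  using integral_distr[OF reflect_measurable assms] by (simp add: distr_reflect)

lemma square_integrable_reflect:
  assumes "u \<in> square_integrable M"
  shows "(\<lambda>x. u (\<sigma> x)) \<in> square_integrable M"
proof -
  have [measurable]: "u \<in> borel_measurable M" by (rule square_integrableD(1)[OF assms])
  have "integrable M (\<lambda>x. (u (\<sigma> x))\<^sup>2)"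
    using integrable_distr[OF reflect_measurable, of "\<lambda>x. (u x)\<^sup>2"] square_integrableD(2)[OF assms]
    by (simp add: distr_reflect)
  then show ?thesis by (simp add: square_integrable_def)
qed

lemma op_reflect:
  assumes u: "u \<in> square_integrable M" and x: "x \<in> space M"
  shows "op (\<lambda>x. u (\<sigma> x)) x = op u (\<sigma> x)"
proof -
  have "op (\<lambda>x. u (\<sigma> x)) x = (\<integral>y. k (\<sigma> x) (\<sigma> y) * u (\<sigma> y) \<partial>M)"
    by (simp add: op_def kernel_reflect)
  also have "\<dots> = (\<integral>y. k (\<sigma> x) y * u y \<partial>M)"
    using integrable_kernel[OF u reflect_in_space[OF x]]
    by (rule integral_reflect[OF borel_measurable_integrable])
  finally show ?thesis by (simp add: op_def)
qed

lemma form_reflect: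
  assumes u: "u \<in> square_integrable M" and v: "v \<in> square_integrable M"
  shows "form (\<lambda>x. u (\<sigma> x)) (\<lambda>x. v (\<sigma> x)) = form u v"
proof -
  have "form (\<lambda>x. u (\<sigma> x)) (\<lambda>x. v (\<sigma> x)) = (\<integral>x. u (\<sigma> x) * op v (\<sigma> x) \<partial>M)"
    unfolding form_def by (intro Bochner_Integration.integral_cong refl) (simp add: op_reflect[OF v])
  also have "\<dots> = form u v"
    unfolding form_def using integrable_form[OF u v]
    by (rule integral_reflect[OF borel_measurable_integrable])
  finally show ?thesis .
qed

lemma form_even_odd:
  assumes s: "s \<in> square_integrable M" "\<And>x. s (\<sigma> x) = s x"
    and d: "d \<in> square_integrable M" "\<And>x. d (\<sigma> x) = - d x"
  shows "form s d = 0"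
  using form_reflect[OF s(1) d(1)] form_cmult_right[of s "-1" d] by (simp add: s(2) d(2))

lemma form_half_even_plus_odd:
  assumes s: "s \<in> square_integrable M" "\<And>x. s (\<sigma> x) = s x"
    and d: "d \<in> square_integrable M" "\<And>x. d (\<sigma> x) = - d x"
  shows "form (\<lambda>x. 1 / 2 * (s x + d x)) (\<lambda>x. 1 / 2 * (s x + d x)) = (form s s + form d d) / 4"
  using form_even_odd[OF s d] form_commute[OF s(1) d(1)] square_integrable_add[OF s(1) d(1)] s(1) d(1)
  by (simp only: form_scale form_add_left form_add_right) (simp add: power2_eq_square)

text \<open>
  On functions that are odd under the reflection, averaging over \<open>y\<close> and \<open>\<sigma> y\<close> replaces \<open>k\<close> by half of
  this kernel. It is positive when both points are on the same side and negative when they are on different sides.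
\<close>

definition folded_kernel :: "'a \<Rightarrow> 'a \<Rightarrow> real" where
  "folded_kernel x y = k x y - k x (\<sigma> y)"

lemma kernel_reflect_square_integrable:
  assumes "x \<in> space M"
  shows "(\<lambda>y. k x (\<sigma> y)) \<in> square_integrable M"
  by (rule square_integrable_reflect[OF kernel_square_integrable[OF assms]])

sublocale folded: bounded_kernel M folded_kernel "4 * C"
proof
  note measurable_kernel[measurable]
  have "(\<lambda>(x, y). k x y - k x (\<sigma> y)) \<in> borel_measurable (M \<Otimes>\<^sub>M M)" by measurable
  then show "(\<lambda>(x, y). folded_kernel x y) \<in> borel_measurable (M \<Otimes>\<^sub>M M)"
    by (simp add: folded_kernel_def[abs_def])
  fix x assume x: "x \<in> space M"
  show "folded_kernel x \<in> square_integrable M"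
    unfolding folded_kernel_def[abs_def]
    by (rule square_integrable_diff[OF kernel_square_integrable[OF x] kernel_reflect_square_integrable[OF x]])
  have zero: "(\<lambda>_. 0) \<in> square_integrable M" by (simp add: square_integrable_def)
  have eq: "(\<integral>y. (k x (\<sigma> y))\<^sup>2 \<partial>M) = (\<integral>y. (k x y)\<^sup>2 \<partial>M)"
    using square_integrableD(2)[OF kernel_square_integrable[OF x]]
    by (rule integral_reflect[OF borel_measurable_integrable])
  have "(\<integral>y. (k x y - k x (\<sigma> y))\<^sup>2 \<partial>M) \<le> 2 * (\<integral>y. (k x y - 0)\<^sup>2 \<partial>M) + 2 * (\<integral>y. (0 - k x (\<sigma> y))\<^sup>2 \<partial>M)"
    by (rule integral_power2_diff_le[OF kernel_square_integrable[OF x] zero kernel_reflect_square_integrable[OF x]])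
  then show "(\<integral>y. (folded_kernel x y)\<^sup>2 \<partial>M) \<le> 4 * C"
    using eq kernel_bound[OF x] by (simp add: folded_kernel_def)
qed

lemma form_odd:
  assumes d: "d \<in> square_integrable M" "\<And>x. d (\<sigma> x) = - d x"
  shows "form d d = (\<integral>(x, y). folded_kernel x y * (d x * d y) \<partial>(M \<Otimes>\<^sub>M M)) / 2"
proof -
  have "folded.op d x = 2 * op d x" if x: "x \<in> space M" for x
  proof -
    have "op (\<lambda>y. d (\<sigma> y)) x = - op d x"
      using op_cmult[of "-1" d x] by (simp add: d(2))
    moreover have "(\<integral>y. k x (\<sigma> y) * d y \<partial>M) = op (\<lambda>y. d (\<sigma> y)) x"
      using integral_reflect[OF borel_measurable_integrable[OF integrable_kernel[OF square_integrable_reflect[OF d(1)] x]]]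
      by (simp add: op_def)
    moreover have "folded.op d x = op d x - (\<integral>y. k x (\<sigma> y) * d y \<partial>M)"
      unfolding folded.op_def folded_kernel_def left_diff_distrib op_def
      using integrable_kernel[OF d(1) x]
        integrable_mult_square_integrable[OF kernel_reflect_square_integrable[OF x] d(1)] by simp
    ultimately show ?thesis by simp
  qed
  then have "folded.form d d = (\<integral>x. 2 * (d x * op d x) \<partial>M)"
    unfolding folded.form_def by (intro Bochner_Integration.integral_cong refl) simp
  then have "folded.form d d = 2 * form d d" by (simp add: form_def)
  then show ?thesis using folded.form_eq_pair[OF d(1) d(1)] by simp
qed

text \<open>
  The odd rearrangement of an odd function that is nonnegative on \<open>H\<close>.
\<close>

definition align_sign :: "('a \<Rightarrow> real) \<Rightarrow> 'a \<Rightarrow> real" where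
  "align_sign d x = (if x \<in> H then \<bar>d x\<bar> else - \<bar>d x\<bar>)"

lemma align_sign_square_integrable:
  assumes "d \<in> square_integrable M"
  shows "align_sign d \<in> square_integrable M"
proof (rule square_integrable_abs_eq[OF assms])
  have [measurable]: "d \<in> borel_measurable M" by (rule square_integrableD(1)[OF assms])
  show "align_sign d \<in> borel_measurable M" unfolding align_sign_def[abs_def] by measurable
qed (simp add: align_sign_def)

lemma odd_cases:
  assumes "d (\<sigma> x) = - d x"
  obtains "d x = (0::real)" | "x \<in> H" "\<sigma> x \<notin> H" | "x \<notin> H" "\<sigma> x \<in> H"
proof (cases "x \<in> H \<or> \<sigma> x \<in> H")
  case False
  then have "\<sigma> x = x" by (simp add: reflect_fixed)
  then show ?thesis using assms that(1) by simp
qed (use reflect_not_in that in blast)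

lemma align_sign_odd:
  assumes "\<And>x. d (\<sigma> x) = - d x"
  shows "align_sign d (\<sigma> x) = - align_sign d x"
  by (rule odd_cases[of d x]) (auto simp: align_sign_def assms)

lemma folded_kernel_reflect_right: "folded_kernel x (\<sigma> y) = - folded_kernel x y"
  by (simp add: folded_kernel_def)

lemma folded_kernel_reflect_left: "folded_kernel (\<sigma> x) y = - folded_kernel x y"
  using kernel_reflect[of x "\<sigma> y"] kernel_reflect[of x y] by (simp add: folded_kernel_def)

lemma folded_kernel_pos:
  assumes "x \<in> H" "y \<in> H" "x \<noteq> y"
  shows "folded_kernel x y > 0"
  using kernel_less[OF assms] by (simp add: folded_kernel_def)

text \<open>
  The signs of \<open>align_sign d x\<close>, \<open>align_sign d y\<close> and the folded kernel always multiply to a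
  nonnegative number: the kernel is negative exactly if the points are on different sides.
\<close>

lemma folded_kernel_align_sign:
  assumes odd: "\<And>x. d (\<sigma> x) = - d x" and ne: "x \<noteq> y" "x \<noteq> \<sigma> y"
  shows "folded_kernel x y * (align_sign d x * align_sign d y) = \<bar>folded_kernel x y * (d x * d y)\<bar>"
proof -
  have ne': "\<sigma> x \<noteq> y" "\<sigma> x \<noteq> \<sigma> y" using ne by (metis reflect_reflect)+
  show ?thesis
  proof (rule odd_cases[of d x, OF odd]; rule odd_cases[of d y, OF odd])
    assume "x \<in> H" "y \<in> H"
    then show ?thesis
      using folded_kernel_pos[of x y] ne by (simp add: align_sign_def abs_mult)
  next
    assume "x \<in> H" "y \<notin> H" "\<sigma> y \<in> H"
    then show ?thesis
      using folded_kernel_pos[of x "\<sigma> y"] ne by (simp add: align_sign_def abs_mult folded_kernel_reflect_right)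
  next
    assume "x \<notin> H" "\<sigma> x \<in> H" "y \<in> H"
    then show ?thesis
      using folded_kernel_pos[of "\<sigma> x" y] ne' by (simp add: align_sign_def abs_mult folded_kernel_reflect_left)
  next
    assume "x \<notin> H" "\<sigma> x \<in> H" "y \<notin> H" "\<sigma> y \<in> H"
    then show ?thesis
      using folded_kernel_pos[of "\<sigma> x" "\<sigma> y"] ne'
      by (simp add: align_sign_def abs_mult folded_kernel_reflect_left folded_kernel_reflect_right)
  qed (simp_all add: align_sign_def)
qed

text \<open>
  After folding, the two forms are integrals of a function and of its absolute value, so equality
  means that the integrand \<open>folded_kernel x y * (d x * d y)\<close> is nonnegative almost everywhere. On
  \<open>H \<times> H\<close> the kernel is positive, so the product of \<open>{d > 0}\<close> and
  \<open>{d < 0}\<close> inside \<open>H\<close> is a null set, and one of the two factors must be null.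
\<close>

lemma form_align_sign:
  assumes d: "d \<in> square_integrable M" and odd: "\<And>x. d (\<sigma> x) = - d x"
  shows "form d d \<le> form (align_sign d) (align_sign d)" (is ?le)
    and "form d d = form (align_sign d) (align_sign d) \<Longrightarrow>
      (AE x in M. x \<in> H \<longrightarrow> 0 \<le> d x) \<or> (AE x in M. x \<in> H \<longrightarrow> d x \<le> 0)" (is "_ \<Longrightarrow> ?eq")
proof -
  let ?M = "M \<Otimes>\<^sub>M M"
  define P where "P = (\<lambda>(x, y). folded_kernel x y * (d x * d y))"
  define Q where "Q = (\<lambda>(x, y). folded_kernel x y * (align_sign d x * align_sign d y))"
  note ad = align_sign_square_integrable[OF d]
  have int: "integrable ?M P" "integrable ?M Q"
    unfolding P_def Q_def by (rule folded.integrable_kernel_pair[OF d d] folded.integrable_kernel_pair[OF ad ad])+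
  have forms: "form d d = integral\<^sup>L ?M P / 2" "form (align_sign d) (align_sign d) = integral\<^sup>L ?M Q / 2"
    unfolding P_def Q_def using form_odd[OF d odd] form_odd[OF ad align_sign_odd[of d, OF odd]] by auto
  have AE_Q: "AE p in ?M. Q p = \<bar>P p\<bar>"
    using AE_off_diagonal
    by (rule AE_mp) (auto intro!: AE_I2 simp: P_def Q_def folded_kernel_align_sign[of d, OF odd])
  have AE_le: "AE p in ?M. P p \<le> Q p" using AE_Q by (auto elim: eventually_mono)
  show ?le
    unfolding forms using integral_mono_AE[OF int AE_le] by simp
  assume "form d d = form (align_sign d) (align_sign d)"
  then have "(\<integral>p. Q p - P p \<partial>?M) = 0" unfolding forms using int by simp
  then have "AE p in ?M. Q p - P p = 0"
    using int AE_le by (subst (asm) integral_nonneg_eq_0_iff_AE) auto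
  then have "AE (x, y) in ?M. 0 \<le> P (x, y) \<and> x \<noteq> y"
    using AE_Q AE_off_diagonal by eventually_elim auto
  then have AE_sign: "AE p in ?M. fst p \<in> H \<and> snd p \<in> H \<longrightarrow> 0 \<le> d (fst p) * d (snd p)"
  proof (rule AE_mp, intro AE_I2 impI)
    fix p assume "case p of (x, y) \<Rightarrow> 0 \<le> P (x, y) \<and> x \<noteq> y" "fst p \<in> H \<and> snd p \<in> H"
    then show "0 \<le> d (fst p) * d (snd p)"
      using folded_kernel_pos[of "fst p" "snd p"] by (auto simp: P_def zero_le_mult_iff split: prod.splits)
  qed
  have [measurable]: "d \<in> borel_measurable M" by (rule square_integrableD(1)[OF d])
  define A where "A = {x \<in> space M. x \<in> H \<and> 0 < d x}"
  define B where "B = {x \<in> space M. x \<in> H \<and> d x < 0}"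
  have [measurable]: "A \<in> sets M" "B \<in> sets M" unfolding A_def B_def by measurable
  have "AE p in ?M. p \<notin> A \<times> B"
    using AE_sign by (rule AE_mp) (auto intro!: AE_I2 simp: A_def B_def zero_le_mult_iff)
  then have "emeasure ?M (A \<times> B) = 0"
    by (subst (asm) AE_iff_null_sets[symmetric]) auto
  then have "emeasure M A = 0 \<or> emeasure M B = 0"
    by (simp add: emeasure_pair_measure_Times)
  then consider "A \<in> null_sets M" | "B \<in> null_sets M" by (auto simp: null_sets_def)
  then show ?eq
  proof cases
    case 1
    have "AE x in M. x \<in> H \<longrightarrow> d x \<le> 0"
      by (rule AE_mp[OF AE_not_in[OF 1]]) (auto intro!: AE_I2 simp: A_def)
    then show ?thesis ..
  next
    case 2
    have "AE x in M. x \<in> H \<longrightarrow> 0 \<le> d x"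
      by (rule AE_mp[OF AE_not_in[OF 2]]) (auto intro!: AE_I2 simp: B_def)
    then show ?thesis ..
  qed
qed

definition polarize :: "('a \<Rightarrow> real) \<Rightarrow> 'a \<Rightarrow> real" where
  "polarize u x = (if x \<in> H then max (u x) (u (\<sigma> x)) else min (u x) (u (\<sigma> x)))"

text \<open>
  Write $u = (s + d)/2$ with $s = u + u\circ\sigma$ even and $d = u - u\circ\sigma$ odd. Because
  $\max(p,q) = (p + q + |p - q|)/2$, polarization keeps $s$ and only aligns the sign of $d$. Even and
  odd functions are orthogonal for the form, so only the energy of the odd part changes.
\<close>

theorem form_polarize:
  assumes u: "u \<in> square_integrable M"
  shows "polarize u \<in> square_integrable M" (is ?sq)
    and "(\<integral>x. (polarize u x)\<^sup>2 \<partial>M) = (\<integral>x. (u x)\<^sup>2 \<partial>M)" (is ?norm)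
    and "form u u \<le> form (polarize u) (polarize u)" (is ?le)
    and "form u u = form (polarize u) (polarize u) \<Longrightarrow>
      (AE x in M. x \<in> H \<longrightarrow> u (\<sigma> x) \<le> u x) \<or> (AE x in M. x \<in> H \<longrightarrow> u x \<le> u (\<sigma> x))" (is "_ \<Longrightarrow> ?eq")
proof -
  define s where "s x = u x + u (\<sigma> x)" for x
  define d where "d x = u x - u (\<sigma> x)" for x
  note ur = square_integrable_reflect[OF u]
  have s: "s \<in> square_integrable M" "s (\<sigma> x) = s x" for x
    unfolding s_def[abs_def] using square_integrable_add[OF u ur] by auto
  have d: "d \<in> square_integrable M" "d (\<sigma> x) = - d x" for x
    unfolding d_def[abs_def] using square_integrable_diff[OF u ur] by auto
  note ad = align_sign_square_integrable[OF d(1)] align_sign_odd[of d, OF d(2)]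
  have u_eq: "u = (\<lambda>x. 1 / 2 * (s x + d x))"
    by (auto simp: s_def d_def)
  have p_eq: "polarize u = (\<lambda>x. 1 / 2 * (s x + align_sign d x))"
    by (auto simp: polarize_def align_sign_def s_def d_def fun_eq_iff max_def min_def)
  show sq: ?sq
    unfolding p_eq by (intro square_integrable_cmult square_integrable_add s ad)
  have forms: "form u u = (form s s + form d d) / 4"
    "form (polarize u) (polarize u) = (form s s + form (align_sign d) (align_sign d)) / 4"
    by (subst u_eq, subst u_eq, rule form_half_even_plus_odd[OF s d])
       (unfold p_eq, rule form_half_even_plus_odd[OF s ad])
  show ?le
    unfolding forms using form_align_sign(1)[OF d] by simp
  show ?eq if "form u u = form (polarize u) (polarize u)"
  proof -
    have "(AE x in M. x \<in> H \<longrightarrow> 0 \<le> d x) \<or> (AE x in M. x \<in> H \<longrightarrow> d x \<le> 0)"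
      using that unfolding forms by (intro form_align_sign(2)[OF d]) simp
    then show ?thesis by (simp add: d_def)
  qed
  have twice: "(\<integral>x. (w x)\<^sup>2 + (w (\<sigma> x))\<^sup>2 \<partial>M) = 2 * (\<integral>x. (w x)\<^sup>2 \<partial>M)"
    if w: "w \<in> square_integrable M" for w
    using integral_reflect[OF borel_measurable_integrable[OF square_integrableD(2)[OF w]]]
      square_integrableD(2)[OF w] square_integrableD(2)[OF square_integrable_reflect[OF w]] by simp
  have "(polarize u x)\<^sup>2 + (polarize u (\<sigma> x))\<^sup>2 = (u x)\<^sup>2 + (u (\<sigma> x))\<^sup>2" for x
  proof (cases "x \<in> H \<or> \<sigma> x \<in> H")
    case True
    then show ?thesis using reflect_not_in[of x] by (auto simp: polarize_def max_def min_def)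
  next
    case False
    then have "\<sigma> x = x" by (simp add: reflect_fixed)
    then show ?thesis by (simp add: polarize_def)
  qed
  then show ?norm
    using twice[OF sq] twice[OF u] by simp
qed

end

section \<open>Reflections of the plane\<close>

context
  fixes a :: "real ^ 2" and b :: real
  assumes a: "a \<noteq> 0"
begin

abbreviation "half \<equiv> {x. a \<bullet> x < b}"

lemma inner_reflection: "a \<bullet> reflection half x = 2 * b - a \<bullet> x"
  using a by (simp add: reflection_halfspace inner_diff_right)

lemma reflection_reflection: "reflection half (reflection half x) = x"
proof -
  have coeff: "2 * (2 * b - a \<bullet> x - b) / (a \<bullet> a) = - (2 * (a \<bullet> x - b) / (a \<bullet> a))"
    by (simp add: minus_divide_left)
  have "reflection half (reflection half x)
      = reflection half x - (2 * (2 * b - a \<bullet> x - b) / (a \<bullet> a)) *\<^sub>R a"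
    by (subst reflection_halfspace[OF a]) (simp only: inner_reflection)
  also have "\<dots> = x"
    unfolding coeff by (simp add: reflection_halfspace[OF a])
  finally show ?thesis .
qed

lemma reflection_boundary: "a \<bullet> x = b \<Longrightarrow> reflection half x = x"
  using a by (simp add: reflection_halfspace)

lemma orthogonal_transformation_reflection:
  "orthogonal_transformation (\<lambda>x. x - (2 * (a \<bullet> x) / (a \<bullet> a)) *\<^sub>R a)"
  unfolding orthogonal_transformation_def
proof (intro conjI allI)
  show "linear (\<lambda>x. x - (2 * (a \<bullet> x) / (a \<bullet> a)) *\<^sub>R a)"
    by (rule linearI)
       (simp_all add: inner_add_right algebra_simps add_divide_distrib)
  show "(v - (2 * (a \<bullet> v) / (a \<bullet> a)) *\<^sub>R a) \<bullet> (w - (2 * (a \<bullet> w) / (a \<bullet> a)) *\<^sub>R a) = v \<bullet> w" for v w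
    using a by (simp add: inner_diff_left inner_diff_right inner_commute)
qed

lemma reflection_eq_translation:
  "reflection half x = (2 * b / (a \<bullet> a)) *\<^sub>R a + (x - (2 * (a \<bullet> x) / (a \<bullet> a)) *\<^sub>R a)"
  using a by (simp add: reflection_halfspace diff_divide_distrib algebra_simps)

lemma reflection_image_eq:
  "reflection half ` S = (+) ((2 * b / (a \<bullet> a)) *\<^sub>R a) ` (\<lambda>x. x - (2 * (a \<bullet> x) / (a \<bullet> a)) *\<^sub>R a) ` S"
  by (simp add: image_image reflection_eq_translation[abs_def])

lemma
  assumes "S \<in> lmeasurable"
  shows lmeasurable_reflection: "reflection half ` S \<in> lmeasurable"
    and measure_reflection: "measure lebesgue (reflection half ` S) = measure lebesgue S"
  unfolding reflection_image_eq
  using assms orthogonal_transformation_reflection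
  by (simp_all add: measurable_translation measurable_orthogonal_image measure_translation measure_orthogonal_image)

lemma norm_reflection_diff: "norm (reflection half x - reflection half y) = norm (x - y)"
proof -
  have "reflection half x - reflection half y
      = (\<lambda>x. x - (2 * (a \<bullet> x) / (a \<bullet> a)) *\<^sub>R a) (x - y)"
    using a by (simp add: reflection_eq_translation inner_diff_right algebra_simps diff_divide_distrib)
  then show ?thesis
    using orthogonal_transformation_norm[OF orthogonal_transformation_reflection] by metis
qed

text \<open>
  The squared distances differ by $4\,(b - a\cdot x)(b - a\cdot y)/|a|^2$, which is positive if
  both points lie in the half-space.
\<close>

lemma norm_diff_reflection_less:
  assumes "x \<in> half" "y \<in> half"
  shows "norm (x - y) < norm (x - reflection half y)"
proof -
  define t where "t = 2 * (a \<bullet> y - b) / (a \<bullet> a)"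
  have aa: "a \<bullet> a > 0" using a by simp
  have eq: "x - reflection half y = (x - y) + t *\<^sub>R a"
    using a by (simp add: reflection_halfspace t_def)
  have "(norm (x - reflection half y))\<^sup>2 = (norm (x - y))\<^sup>2 + 2 * t * (a \<bullet> x - a \<bullet> y) + t * (t * (a \<bullet> a))"
    unfolding eq power2_norm_eq_inner
    by (simp add: inner_add_left inner_add_right inner_diff_left inner_diff_right inner_commute algebra_simps)
  also have "t * (a \<bullet> a) = 2 * (a \<bullet> y - b)" using aa by (simp add: t_def)
  finally have "(norm (x - reflection half y))\<^sup>2 = (norm (x - y))\<^sup>2 + 2 * (t * (a \<bullet> x - b))"
    by (simp add: algebra_simps)
  moreover have "t < 0" using assms aa by (simp add: t_def divide_neg_pos)
  then have "t * (a \<bullet> x - b) > 0" using assms by (simp add: mult_neg_neg)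
  ultimately have "(norm (x - y))\<^sup>2 < (norm (x - reflection half y))\<^sup>2" by simp
  then show ?thesis by (rule power_less_imp_less_base) simp
qed

text \<open>
  A disc centred on the axis is invariant, which gives a finite measure space on which the
  reflection acts.
\<close>

lemma reflection_cball_image:
  assumes "a \<bullet> p = b"
  shows "reflection half x \<in> cball p r \<longleftrightarrow> x \<in> cball p r"
  using norm_reflection_diff[of p x] reflection_boundary[OF assms] by (simp add: dist_norm)

lemma
  assumes p: "a \<bullet> p = b"
  shows measurable_reflection: "reflection half \<in> measurable (lebesgue_on (cball p r)) (lebesgue_on (cball p r))"
    and distr_reflection: "distr (lebesgue_on (cball p r)) (lebesgue_on (cball p r)) (reflection half)
      = lebesgue_on (cball p r)"
proof -
  let ?M = "lebesgue_on (cball p r)"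
  let ?s = "reflection half"
  have sp: "space ?M = cball p r" by (simp add: space_restrict_space)
  have sets_lm: "X \<subseteq> cball p r \<and> X \<in> lmeasurable" if "X \<in> sets ?M" for X
    using that by (auto simp: sets_restrict_space intro: fmeasurable_Int_fmeasurable fmeasurableI2[OF lmeasurable_cball])
  have lm_sets: "X \<in> sets ?M" if "X \<subseteq> cball p r" "X \<in> lmeasurable" for X
    using that by (auto simp: sets_restrict_space_iff fmeasurableD)
  have vimage: "?s -` X \<inter> space ?M = ?s ` X" if "X \<subseteq> cball p r" for X
    using that reflection_cball_image[OF p] unfolding sp by (auto simp: image_iff) (metis reflection_reflection)+
  have img: "?s ` X \<subseteq> cball p r" if "X \<subseteq> cball p r" for X
    using that reflection_cball_image[OF p] by blast
  show meas: "?s \<in> measurable ?M ?M"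
  proof (rule measurableI)
    show "?s x \<in> space ?M" if "x \<in> space ?M" for x
      using that reflection_cball_image[OF p] by (simp only: sp)
    show "?s -` X \<inter> space ?M \<in> sets ?M" if "X \<in> sets ?M" for X
    proof -
      have X: "X \<subseteq> cball p r" "X \<in> lmeasurable" using sets_lm[OF that] by auto
      show ?thesis
        unfolding vimage[OF X(1)] by (rule lm_sets[OF img[OF X(1)] lmeasurable_reflection[OF X(2)]])
    qed
  qed
  have em: "emeasure ?M X = ennreal (measure lebesgue X)" if "X \<subseteq> cball p r" "X \<in> lmeasurable" for X
    using that by (simp add: emeasure_restrict_space emeasure_eq_measure2)
  show "distr ?M ?M ?s = ?M"
  proof (rule measure_eqI)
    fix X assume "X \<in> sets (distr ?M ?M ?s)"
    then have X: "X \<in> sets ?M" by simp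
    have "emeasure (distr ?M ?M ?s) X = emeasure ?M (?s ` X)"
      using sets_lm[OF X] by (subst emeasure_distr[OF meas X], subst vimage) auto
    then show "emeasure (distr ?M ?M ?s) X = emeasure ?M X"
      using sets_lm[OF X] by (simp add: em img lmeasurable_reflection measure_reflection)
  qed simp
qed

lemma AE_lebesgue_on_pair_neq:
  assumes p: "a \<bullet> p = b" and M_def: "M = lebesgue_on (cball p r)"
  shows "AE (x, y) in M \<Otimes>\<^sub>M M. x \<noteq> y \<and> x \<noteq> reflection half y"
proof -
  have fin: "finite_measure M"
    unfolding M_def by (rule finite_measure_lebesgue_on) simp
  interpret finite_measure M by (rule fin)
  interpret pair_sigma_finite M M ..
  have id: "(\<lambda>x. x) \<in> borel_measurable M"
    unfolding M_def by (intro borel_measurable_lebesgue_on_of_borel) simp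
  have refl: "reflection half \<in> borel_measurable M"
    using measurable_compose[OF measurable_reflection[OF p] id[unfolded M_def]] by (simp add: M_def)
  note [measurable] = measurable_compose[OF measurable_fst id] measurable_compose[OF measurable_snd id]
    measurable_compose[OF measurable_snd refl]
  have "AE z in M \<Otimes>\<^sub>M M. fst z \<noteq> snd z \<and> fst z \<noteq> reflection half (snd z)"
  proof (rule AE_pair_measure)
    show "{z \<in> space (M \<Otimes>\<^sub>M M). fst z \<noteq> snd z \<and> fst z \<noteq> reflection half (snd z)} \<in> sets (M \<Otimes>\<^sub>M M)"
      by measurable
    have "AE y in M. y \<noteq> x \<and> y \<noteq> reflection half x" for x
      unfolding M_def using AE_lebesgue_on_neq[of "cball p r" x] AE_lebesgue_on_neq[of "cball p r" "reflection half x"]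
      by simp
    then have "AE y in M. x \<noteq> y \<and> x \<noteq> reflection half y" for x
      by (rule AE_mp) (auto intro!: AE_I2 simp: reflection_reflection)
    then show "AE x in M. AE y in M. fst (x, y) \<noteq> snd (x, y) \<and> fst (x, y) \<noteq> reflection half (snd (x, y))"
      by simp
  qed
  then show ?thesis by (simp add: case_prod_beta)
qed

lemma reflection_kernel_log_kernel:
  assumes p: "a \<bullet> p = b" and R: "cball p r \<subseteq> cball 0 R"
  shows "reflection_kernel (lebesgue_on (cball p r)) log_kernel
    (2 * layer_const + 8 * R\<^sup>2 * measure lebesgue (cball p r)) (reflection half) half"
proof -
  let ?M = "lebesgue_on (cball p r)"
  interpret symmetric_kernel ?M log_kernel "2 * layer_const + 8 * R\<^sup>2 * measure lebesgue (cball p r)"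
    by (rule symmetric_kernel_log_kernel[OF _ R]) simp
  show ?thesis
  proof
    show "Measurable.pred ?M (\<lambda>x. x \<in> half)"
    proof -
      have "half \<inter> cball p r \<in> sets ?M"
        by (auto simp: sets_restrict_space intro!: image_eqI[of _ _ half] borel_open open_halfspace_lt)
      then show ?thesis by (simp add: pred_def space_restrict_space Int_commute Int_def conj_commute)
    qed
    show "log_kernel x (reflection half y) < log_kernel x y" if "x \<in> half" "y \<in> half" "x \<noteq> y" for x y
    proof -
      have *: "norm (x - y) < norm (x - reflection half y)" by (rule norm_diff_reflection_less[OF that(1,2)])
      have pos: "0 < norm (x - y)" using that by simp
      then have "ln (norm (x - y)) < ln (norm (x - reflection half y))"
        using * by (subst ln_less_cancel_iff) auto
      then show ?thesis
        using pos less_trans[OF pos *] by (simp add: log_kernel_def ln_div)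
    qed
    show "reflection half x \<notin> half" if "x \<in> half" for x
      using that by (simp add: inner_reflection)
    show "reflection half x = x" if "x \<notin> half" "reflection half x \<notin> half" for x
      using that by (intro reflection_boundary) (simp add: inner_reflection)
  qed (use measurable_reflection[OF p] distr_reflection[OF p] AE_lebesgue_on_pair_neq[OF p refl] in
      \<open>auto simp: reflection_reflection log_kernel_def norm_reflection_diff\<close>)
qed

end

section \<open>Functions supported in a smaller set\<close>

lemma
  fixes h :: "'a::euclidean_space \<Rightarrow> real"
  assumes S: "S \<in> sets lebesgue" "B \<in> sets lebesgue" "S \<subseteq> B" and zero: "\<And>x. x \<in> B - S \<Longrightarrow> h x = 0"
  shows integral_lebesgue_on_support: "integral\<^sup>L (lebesgue_on B) h = integral\<^sup>L (lebesgue_on S) h"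
    and integrable_lebesgue_on_support: "integrable (lebesgue_on B) h \<longleftrightarrow> integrable (lebesgue_on S) h"
    and measurable_lebesgue_on_support: "h \<in> borel_measurable (lebesgue_on B) \<longleftrightarrow> h \<in> borel_measurable (lebesgue_on S)"
proof -
  \<comment> \<open>Both restricted measures reduce to integrals over the whole plane of the same function.\<close>
  have eq: "(\<lambda>x. indicator B x *\<^sub>R h x) = (\<lambda>x. indicator S x *\<^sub>R h x)"
    using S(3) zero by (auto simp: fun_eq_iff split: split_indicator)
  show "integral\<^sup>L (lebesgue_on B) h = integral\<^sup>L (lebesgue_on S) h"
    using S by (simp add: integral_restrict_space eq[simplified])
  show "integrable (lebesgue_on B) h \<longleftrightarrow> integrable (lebesgue_on S) h"
    using S by (simp add: integrable_restrict_space eq[simplified])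
  show "h \<in> borel_measurable (lebesgue_on B) \<longleftrightarrow> h \<in> borel_measurable (lebesgue_on S)"
    using S by (simp add: borel_measurable_restrict_space_iff eq[simplified])
qed

lemma square_integrable_lebesgue_on_support:
  fixes h :: "'a::euclidean_space \<Rightarrow> real"
  assumes "S \<in> sets lebesgue" "B \<in> sets lebesgue" "S \<subseteq> B" "\<And>x. x \<in> B - S \<Longrightarrow> h x = 0"
  shows "h \<in> square_integrable (lebesgue_on B) \<longleftrightarrow> h \<in> square_integrable (lebesgue_on S)"
  using integrable_lebesgue_on_support[of S B "\<lambda>x. (h x)\<^sup>2"] measurable_lebesgue_on_support[of S B h] assms
  by (auto simp: square_integrable_def)

section \<open>Polarization and the largest eigenvalue\<close>

theorem theorem1p5:
  fixes \<Omega> H :: "(real ^ 2) set" and u :: "real ^ 2 \<Rightarrow> real"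
  assumes "open \<Omega>" and "bounded \<Omega>"
    and "polarizer H"
    and "log_eigenfunction \<Omega> (tau1 \<Omega>) u" and "continuous_on \<Omega> u"
    and "\<And>x. x \<in> \<Omega> - reflection H ` \<Omega> \<Longrightarrow> u x > 0"
  shows "tau1 \<Omega> \<le> tau1 (polarization H \<Omega>) \<and>
    (tau1 \<Omega> = tau1 (polarization H \<Omega>) \<longrightarrow>
       polarization H \<Omega> \<cong>\<^sub>0 \<Omega> \<or> polarization H \<Omega> \<cong>\<^sub>0 reflection H ` \<Omega>)"
proof -
  obtain a b where a: "a \<noteq> 0" and H: "H = {x. a \<bullet> x < b}"
    using \<open>polarizer H\<close> by (auto simp: polarizer_def)
  \<comment> \<open>A point of the axis, as centre of a reflection-invariant disc containing everything.\<close>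
  define p where "p = (b / (a \<bullet> a)) *\<^sub>R a"
  have p: "a \<bullet> p = b" using a by (simp add: p_def)
  obtain r where r: "\<Omega> \<subseteq> cball p r"
    using bounded_subset_ballD[OF \<open>bounded \<Omega>\<close>, of p] ball_subset_cball by blast
  obtain R where R: "cball p r \<subseteq> cball 0 R"
    using bounded_subset_ballD[OF bounded_cball[of p r], of 0] ball_subset_cball by blast
  define B where "B = cball p r"
  define \<sigma> where "\<sigma> = reflection H"
  define P where "P = polarization H \<Omega>"
  interpret reflection_kernel "lebesgue_on B" log_kernel
    "2 * layer_const + 8 * R\<^sup>2 * measure lebesgue (cball p r)" \<sigma> H
    using reflection_kernel_log_kernel[OF a p R] unfolding B_def \<sigma>_def H .
  have sB: "\<sigma> x \<in> B \<longleftrightarrow> x \<in> B" for x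
    unfolding \<sigma>_def H B_def by (rule reflection_cball_image[OF a p])
  have in_image: "x \<in> \<sigma> ` S \<longleftrightarrow> \<sigma> x \<in> S" for x S
    by (metis imageE image_eqI reflect_reflect)
  have P_iff: "x \<in> P \<longleftrightarrow> (if x \<in> H then x \<in> \<Omega> \<or> \<sigma> x \<in> \<Omega> else x \<in> \<Omega> \<and> \<sigma> x \<in> \<Omega>)" for x
    unfolding P_def polarization_def \<sigma>_def[symmetric] by (auto simp: in_image)
  have pos: "u x > 0" if "x \<in> \<Omega>" "\<sigma> x \<notin> \<Omega>" for x
    using assms(6)[of x] that in_image unfolding \<sigma>_def by blast
  have B_sets: "B \<in> sets lebesgue" by (simp add: B_def)
  have \<Omega>B: "\<Omega> \<subseteq> B" using r by (simp add: B_def)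
  have PB: "P \<subseteq> B"
  proof
    fix x assume "x \<in> P"
    then have "x \<in> \<Omega> \<or> \<sigma> x \<in> \<Omega>" by (auto simp: P_iff split: if_splits)
    then show "x \<in> B" using \<Omega>B sB[of x] by blast
  qed
  have cont: "continuous_on UNIV \<sigma>"
    unfolding \<sigma>_def H reflection_halfspace[OF a, abs_def] by (intro continuous_intros) (use a in auto)
  have open_vimage: "open {x. \<sigma> x \<in> \<Omega>}"
    using open_vimage[OF \<open>open \<Omega>\<close> cont] by (simp add: vimage_def)
  have open_P: "open P"
  proof -
    have "P = (\<Omega> \<union> {x. \<sigma> x \<in> \<Omega>}) \<inter> H \<union> \<Omega> \<inter> {x. \<sigma> x \<in> \<Omega>}"
      by (auto simp: P_iff split: if_splits)
    then show ?thesis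
      using \<open>open \<Omega>\<close> open_vimage by (simp add: H open_halfspace_lt open_Int open_Un)
  qed
  have bounded_P: "bounded P" using PB by (auto simp: B_def intro: bounded_subset)
  have "\<sigma> ` \<Omega> = {x. \<sigma> x \<in> \<Omega>}" using in_image by blast
  then have sets: "\<Omega> \<in> sets lebesgue" "P \<in> sets lebesgue" "\<sigma> ` \<Omega> \<in> sets lebesgue"
    using \<open>open \<Omega>\<close> open_P open_vimage by auto
  \<comment> \<open>With the extension by zero, positivity off the mirror image makes the
    polarized function vanish off the polarized set.\<close>
  define f where "f x = (if x \<in> \<Omega> then u x else 0)" for x
  have u: "u \<in> square_integrable (lebesgue_on \<Omega>)" "\<not> (AE x in lebesgue_on \<Omega>. u x = 0)"
    "AE x in lebesgue_on \<Omega>. log_potential \<Omega> u x = tau1 \<Omega> * u x"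
    using assms(4) by (auto simp: log_eigenfunction_def L2_on_eq)
  have space_\<Omega>: "space (lebesgue_on \<Omega>) = \<Omega>" by (simp add: space_restrict_space)
  have f_\<Omega>: "f \<in> square_integrable (lebesgue_on \<Omega>)"
  proof (rule square_integrable_abs_eq[OF u(1)])
    have "f \<in> borel_measurable (lebesgue_on \<Omega>) \<longleftrightarrow> u \<in> borel_measurable (lebesgue_on \<Omega>)"
      by (rule measurable_cong) (simp add: f_def space_\<Omega>)
    then show "f \<in> borel_measurable (lebesgue_on \<Omega>)" using square_integrableD(1)[OF u(1)] by simp
  qed (simp add: f_def)
  have f: "f \<in> square_integrable (lebesgue_on B)"
    using f_\<Omega> by (subst square_integrable_lebesgue_on_support[OF sets(1) B_sets \<Omega>B]) (auto simp: f_def)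
  have form_support: "form w w = 2 * pi * (\<integral>x. w x * log_potential S w x \<partial>lebesgue_on S)"
    "(\<integral>x. (w x)\<^sup>2 \<partial>lebesgue_on B) = (\<integral>x. (w x)\<^sup>2 \<partial>lebesgue_on S)"
    if S: "S \<in> sets lebesgue" "S \<subseteq> B" and zero: "\<And>x. x \<in> B - S \<Longrightarrow> w x = 0" for S w
  proof -
    have op: "op w x = 2 * pi * log_potential S w x" for x
      unfolding op_def log_potential_eq
      using integral_lebesgue_on_support[OF S(1) B_sets S(2), of "\<lambda>y. log_kernel x y * w y"] zero by simp
    have "form w w = (\<integral>x. 2 * pi * (w x * log_potential S w x) \<partial>lebesgue_on B)"
      unfolding form_def op by (simp only: mult.left_commute)
    also have "\<dots> = (\<integral>x. 2 * pi * (w x * log_potential S w x) \<partial>lebesgue_on S)"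
      by (rule integral_lebesgue_on_support[OF S(1) B_sets S(2)]) (simp add: zero)
    finally show "form w w = 2 * pi * (\<integral>x. w x * log_potential S w x \<partial>lebesgue_on S)"
      by simp
    show "(\<integral>x. (w x)\<^sup>2 \<partial>lebesgue_on B) = (\<integral>x. (w x)\<^sup>2 \<partial>lebesgue_on S)"
      by (rule integral_lebesgue_on_support[OF S(1) B_sets S(2)]) (simp add: zero)
  qed
  let ?n = "\<integral>x. (f x)\<^sup>2 \<partial>lebesgue_on B"
  have n_eq: "?n = (\<integral>x. (u x)\<^sup>2 \<partial>lebesgue_on \<Omega>)"
  proof -
    have "?n = (\<integral>x. (f x)\<^sup>2 \<partial>lebesgue_on \<Omega>)"
      by (rule integral_lebesgue_on_support[OF sets(1) B_sets \<Omega>B]) (simp add: f_def)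
    also have "\<dots> = (\<integral>x. (u x)\<^sup>2 \<partial>lebesgue_on \<Omega>)"
      by (intro Bochner_Integration.integral_cong refl) (simp add: f_def space_\<Omega>)
    finally show ?thesis .
  qed
  have n: "?n > 0" unfolding n_eq by (rule not_AE_zero_imp_integral_pos[OF u(1,2)])
  have form_f: "form f f = 2 * pi * tau1 \<Omega> * ?n"
  proof -
    have pot: "op f x = 2 * pi * log_potential \<Omega> u x" for x
    proof -
      have "op f x = (\<integral>y. log_kernel x y * f y \<partial>lebesgue_on \<Omega>)"
        unfolding op_def
        by (rule integral_lebesgue_on_support[OF sets(1) B_sets \<Omega>B]) (simp add: f_def)
      also have "\<dots> = (\<integral>y. log_kernel x y * u y \<partial>lebesgue_on \<Omega>)"
        by (intro Bochner_Integration.integral_cong refl) (simp add: f_def space_\<Omega>)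
      finally show ?thesis by (simp add: log_potential_eq)
    qed
    have "AE x in lebesgue. x \<in> \<Omega> \<longrightarrow> log_potential \<Omega> u x = tau1 \<Omega> * u x"
      using u(3) sets(1) by (subst (asm) AE_restrict_space_iff) auto
    then have "AE x in lebesgue. x \<in> B \<longrightarrow> f x * op f x = 2 * pi * tau1 \<Omega> * (f x)\<^sup>2"
      by (rule AE_mp) (auto intro!: AE_I2 simp: f_def pot power2_eq_square)
    then have "AE x in lebesgue_on B. f x * op f x = 2 * pi * tau1 \<Omega> * (f x)\<^sup>2"
      using B_sets by (subst AE_restrict_space_iff) auto
    then have "form f f = (\<integral>x. 2 * pi * tau1 \<Omega> * (f x)\<^sup>2 \<partial>lebesgue_on B)"
      unfolding form_def
      using borel_measurable_integrable[OF integrable_form[OF f f]] square_integrableD[OF f]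
      by (intro integral_cong_AE) auto
    then show ?thesis by simp
  qed
  define v where "v = polarize f"
  note v = form_polarize[OF f, folded v_def]
  have v_zero: "v x = 0" if "x \<in> B - P" for x
    using that pos[of x] pos[of "\<sigma> x"] by (auto simp: v_def polarize_def f_def P_iff split: if_splits)
  note v_support = form_support[OF sets(2) PB v_zero]
  have v_P: "v \<in> square_integrable (lebesgue_on P)"
    using v(1) by (subst (asm) square_integrable_lebesgue_on_support[OF sets(2) B_sets PB v_zero]) auto
  have "P \<noteq> {}"
  proof
    assume "P = {}"
    then have "space (lebesgue_on P) = {}" by (simp add: space_restrict_space)
    then have "(\<integral>x. (v x)\<^sup>2 \<partial>lebesgue_on P) = 0" by (intro integral_eq_zero_AE AE_I2) auto
    then show False using n v(2) v_support(2) by simp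
  qed
  have form_v: "form v v \<le> 2 * pi * tau1 P * ?n"
    using log_form_le_tau1[OF open_P bounded_P \<open>P \<noteq> {}\<close> v_P] v_support v(2) by simp
  have "tau1 \<Omega> \<le> tau1 P"
  proof -
    have "2 * pi * tau1 \<Omega> * ?n \<le> 2 * pi * tau1 P * ?n"
      using form_f form_v v(3) by linarith
    then show ?thesis using n by simp
  qed
  moreover have "P \<cong>\<^sub>0 \<Omega> \<or> P \<cong>\<^sub>0 \<sigma> ` \<Omega>" if eq: "tau1 \<Omega> = tau1 P"
  proof -
    have "form f f = form v v" using form_f form_v v(3) eq by simp
    then have sign: "(AE x in lebesgue_on B. x \<in> H \<longrightarrow> f (\<sigma> x) \<le> f x) \<or>
        (AE x in lebesgue_on B. x \<in> H \<longrightarrow> f x \<le> f (\<sigma> x))"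
      by (rule v(4))
    have reflected: "AE x in lebesgue_on B. Q (\<sigma> x)" if "AE x in lebesgue_on B. Q x" for Q
      using AE_distrD[OF reflect_measurable, of Q] that unfolding distr_reflect by blast
    have ess: "P \<cong>\<^sub>0 S"
      if S: "S \<in> sets lebesgue" "S \<subseteq> B" and AE: "AE x in lebesgue_on B. x \<notin> sym_diff P S" for S
    proof -
      have "AE x in lebesgue. x \<in> B \<longrightarrow> x \<notin> sym_diff P S"
        using AE B_sets by (subst (asm) AE_restrict_space_iff) auto
      then have "AE x in lebesgue. x \<notin> sym_diff P S"
        using S(2) PB by (auto elim!: eventually_mono)
      then show ?thesis
        unfolding ess_equal_def using S(1) sets(2) by (subst AE_iff_null_sets) auto
    qed
    \<comment> \<open>A fixed point of the reflection lies in both the set and its mirror image or in neither.\<close>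
    have H_cases: "\<sigma> x \<in> H" if "x \<notin> H" "x \<in> \<Omega> \<longleftrightarrow> \<sigma> x \<notin> \<Omega>" for x
      using reflect_fixed[of x] that by metis
    from sign show ?thesis
    proof
      assume AE: "AE x in lebesgue_on B. x \<in> H \<longrightarrow> f (\<sigma> x) \<le> f x"
      have "AE x in lebesgue_on B. x \<notin> sym_diff P \<Omega>"
        using AE reflected[OF AE]
      proof eventually_elim
        case (elim x)
        then show ?case
          using pos[of x] pos[of "\<sigma> x"] H_cases[of x]
          by (auto simp: P_iff f_def split: if_splits)
      qed
      then show ?thesis using ess[OF sets(1) \<Omega>B] by blast
    next
      assume AE: "AE x in lebesgue_on B. x \<in> H \<longrightarrow> f x \<le> f (\<sigma> x)"
      have "AE x in lebesgue_on B. x \<notin> sym_diff P (\<sigma> ` \<Omega>)"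
        using AE reflected[OF AE]
      proof eventually_elim
        case (elim x)
        then show ?case
          using pos[of x] pos[of "\<sigma> x"] H_cases[of x]
          by (auto simp: P_iff f_def in_image split: if_splits)
      qed
      then show ?thesis using ess[OF sets(3)] \<Omega>B sB by blast
    qed
  qed
  ultimately show ?thesis unfolding P_def \<sigma>_def by blast
qed

end
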